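(* Let $\phi:\mathcal{H}\to\mathbb{C}$ be a nonzero Lie algebra homomorphism and let $V$ be a quasi-Whittaker module of type $\phi$ for $\mathfrak{S}$ with cyclic quasi-Whittaker vector $w$. Assume that $\mathrm{Ann}_{\mathbb{C}[C_0]}(w)\neq 0$, and let $d(C_0)=\prod_{i=1}^{k}(C_0-\xi_i 1)^{a_i}$, with $\xi_1,\dots,\xi_k\in\mathbb{C}$ distinct and $a_i\geq 1$ integers, be the unique monic generator of the ideal $\mathrm{Ann}_{\mathbb{C}[C_0]}(w)$ in $\mathbb{C}[C_0]$. (i) Define $V_{\phi,\xi_i}=\mathcal{U}(\mathfrak{S})(C_0-\xi_i)w$ for $i=1,\dots,k$. Then $V_{\phi,\xi_1},\dots,V_{\phi,\xi_k}$ are the only maximal submodules of $V$. (ii) For $j=1,\dots,k$ define $d_j(C_0)=\prod_{i\neq j}(C_0-\xi_i 1)^{a_i}$, $w_j=d_j(C_0)w$ and $V_j=\mathcal{U}(\mathfrak{S})w_j$. Then each $V_j$ is a quasi-Whittaker module of type $\phi$ with cyclic quasi-Whittaker vector $w_j$, and $V=V_1\oplus\cdots\oplus V_k$. Furthermore, the submodules $V_1,\dots,V_k$ are indecomposable; $V_j$ is simple if and only if $a_j=1$; and $a_j$ is the composition length of $V_j$. In particular, $V$ has a composition series of length $\sum_{i=1}^k a_i$.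
   Context: The Schrödinger algebra $\mathfrak{S}$ is the complex Lie algebra with basis $e,h,f,p,q,z$ and brackets $[h,e]=2e$, $[h,f]=-2f$, $[e,f]=h$, $[h,p]=p$, $[h,q]=-q$, $[p,q]=z$, $[e,q]=p$, $[p,f]=-q$, $[f,q]=0$, $[e,p]=0$, $[z,\mathfrak{S}]=0$. Its Heisenberg subalgebra is $\mathcal{H}=\mathrm{span}_{\mathbb{C}}\{p,q,z\}$. For a Lie algebra homomorphism $\phi:\mathcal{H}\to\mathbb{C}$ (so $\phi(z)=0$) and an $\mathfrak{S}$-module $V$, a nonzero vector $v\in V$ is a quasi-Whittaker vector of type $\phi$ if $xv=\phi(x)v$ for all $x\in\mathcal{H}$. $V$ is a quasi-Whittaker module of type $\phi$ if it contains a cyclic quasi-Whittaker vector $v$ of type $\phi$, i.e. one with $V=\mathcal{U}(\mathfrak{S})v$. Put $C_0=p^2f-q^2e-hpq\in\mathcal{U}(\mathfrak{S})$; $\mathbb{C}[C_0]$ is the (polynomial) subalgebra of $\mathcal{U}(\mathfrak{S})$ generated by $C_0$, and $\mathrm{Ann}_{\mathbb{C}[C_0]}(w)=\{a\in\mathbb{C}[C_0] : aw=0\}$. *)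

theory Defs
  imports
    "HOL-Analysis.Analysis"
    "HOL-Library.Poly_Mapping"
    "HOL-Computational_Algebra.Polynomial"
begin

datatype gen = GE | GH | GF | GP | GQ | GZ

lemma UNIV_gen: "(UNIV :: gen set) = {GE, GH, GF, GP, GQ, GZ}"
proof -
  have "x \<in> {GE, GH, GF, GP, GQ, GZ}" for x
    by (cases x) simp_all
  then show ?thesis
    by blast
qed

instance gen :: finite
  by standard (simp add: UNIV_gen)

type_synonym schrodinger = "complex ^ gen"

abbreviation basis_vec :: "gen \<Rightarrow> schrodinger" where
  "basis_vec i \<equiv> axis i 1"

text \<open>Only one orientation of each nonzero bracket of basis vectors is listed;
  antisymmetry is built into the definition of \<open>lie_bracket\<close>.\<close>

fun base_bracket :: "gen \<Rightarrow> gen \<Rightarrow> schrodinger" where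
  "base_bracket GH GE = 2 *s basis_vec GE"
| "base_bracket GH GF = (-2) *s basis_vec GF"
| "base_bracket GE GF = basis_vec GH"
| "base_bracket GH GP = basis_vec GP"
| "base_bracket GH GQ = - basis_vec GQ"
| "base_bracket GP GQ = basis_vec GZ"
| "base_bracket GE GQ = basis_vec GP"
| "base_bracket GP GF = - basis_vec GQ"
| "base_bracket _ _ = 0"

definition lie_bracket :: "schrodinger \<Rightarrow> schrodinger \<Rightarrow> schrodinger" where
  "lie_bracket x y =
     (\<Sum>i\<in>UNIV. \<Sum>j\<in>UNIV. (x $ i * y $ j) *s (base_bracket i j - base_bracket j i))"

lemma gen_sum: "(\<Sum>i\<in>(UNIV :: gen set). f i) = f GE + f GH + f GF + f GP + f GQ + f GZ"
  by (simp add: UNIV_gen algebra_simps)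

lemma lie_bracket_basis: "lie_bracket (basis_vec i) (basis_vec j) = base_bracket i j - base_bracket j i"
  by (cases i; cases j; simp add: lie_bracket_def gen_sum axis_def)

lemma lie_bracket_component:
  "lie_bracket x y $ k =
     (case k of
        GE \<Rightarrow> 2 * (x $ GH * y $ GE - x $ GE * y $ GH)
      | GH \<Rightarrow> x $ GE * y $ GF - x $ GF * y $ GE
      | GF \<Rightarrow> - 2 * (x $ GH * y $ GF - x $ GF * y $ GH)
      | GP \<Rightarrow> x $ GH * y $ GP - x $ GP * y $ GH + (x $ GE * y $ GQ - x $ GQ * y $ GE)
      | GQ \<Rightarrow> - (x $ GH * y $ GQ - x $ GQ * y $ GH) - (x $ GP * y $ GF - x $ GF * y $ GP)
      | GZ \<Rightarrow> x $ GP * y $ GQ - x $ GQ * y $ GP)"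
  by (cases k) (simp_all add: lie_bracket_def gen_sum axis_def algebra_simps)

lemma lie_bracket_alternating: "lie_bracket x x = 0"
  by (simp add: vec_eq_iff lie_bracket_component split: gen.split)

lemma lie_bracket_jacobi:
  "lie_bracket x (lie_bracket y z) + lie_bracket y (lie_bracket z x)
     + lie_bracket z (lie_bracket x y) = 0"
  by (simp add: vec_eq_iff lie_bracket_component algebra_simps split: gen.split)

definition heisenberg :: "schrodinger set" where
  "heisenberg = vec.span {basis_vec GP, basis_vec GQ, basis_vec GZ}"

text \<open>Only the values on \<open>heisenberg\<close> matter. The target \<open>\<complex>\<close> is an abelian Lie algebra.\<close>

definition heisenberg_hom :: "(schrodinger \<Rightarrow> complex) \<Rightarrow> bool" where
  "heisenberg_hom \<phi> \<longleftrightarrow>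
     (\<forall>x\<in>heisenberg. \<forall>y\<in>heisenberg. \<phi> (x + y) = \<phi> x + \<phi> y) \<and>
     (\<forall>c. \<forall>x\<in>heisenberg. \<phi> (c *s x) = c * \<phi> x) \<and>
     (\<forall>x\<in>heisenberg. \<forall>y\<in>heisenberg. \<phi> (lie_bracket x y) = \<phi> x * \<phi> y - \<phi> y * \<phi> x)"

text \<open>Words in the basis, a monoid under concatenation. The monoid algebra
  \<open>gword \<Rightarrow>\<^sub>0 complex\<close> is the free algebra on the basis, i.e. the tensor algebra
  of the Schroedinger algebra.\<close>

datatype gword = Word (letters: "gen list")

instantiation gword :: monoid_add
begin
definition zero_gword :: gword where "zero_gword = Word []"
definition plus_gword :: "gword \<Rightarrow> gword \<Rightarrow> gword" where
  "plus_gword u v = Word (letters u @ letters v)"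
instance
  by standard (simp_all add: zero_gword_def plus_gword_def)
end

type_synonym tensor_alg = "gword \<Rightarrow>\<^sub>0 complex"

definition tensor_of :: "schrodinger \<Rightarrow> tensor_alg" where
  "tensor_of x = (\<Sum>i\<in>UNIV. Poly_Mapping.single (Word [i]) (x $ i))"

definition two_sided_ideal :: "'a::ring_1 set \<Rightarrow> bool" where
  "two_sided_ideal I \<longleftrightarrow>
     0 \<in> I \<and> (\<forall>a\<in>I. \<forall>b\<in>I. a + b \<in> I) \<and> (\<forall>a\<in>I. \<forall>r. r * a \<in> I \<and> a * r \<in> I)"

definition uea_relations :: "tensor_alg set" where
  "uea_relations =
     {tensor_of x * tensor_of y - tensor_of y * tensor_of x - tensor_of (lie_bracket x y) | x y. True}"

definition uea_ideal :: "tensor_alg set" where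
  "uea_ideal = \<Inter> {I. two_sided_ideal I \<and> uea_relations \<subseteq> I}"

lemma two_sided_ideal_uminus: "two_sided_ideal I \<Longrightarrow> a \<in> I \<Longrightarrow> - a \<in> I"
  unfolding two_sided_ideal_def by (metis mult_minus1)

lemma two_sided_ideal_uea_ideal: "two_sided_ideal uea_ideal"
  unfolding uea_ideal_def two_sided_ideal_def by blast

lemma uea_ideal_zero: "0 \<in> uea_ideal"
  and uea_ideal_add: "a \<in> uea_ideal \<Longrightarrow> b \<in> uea_ideal \<Longrightarrow> a + b \<in> uea_ideal"
  and uea_ideal_mult_left: "a \<in> uea_ideal \<Longrightarrow> r * a \<in> uea_ideal"
  and uea_ideal_mult_right: "a \<in> uea_ideal \<Longrightarrow> a * r \<in> uea_ideal"
  and uea_ideal_uminus: "a \<in> uea_ideal \<Longrightarrow> - a \<in> uea_ideal"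
  using two_sided_ideal_uea_ideal two_sided_ideal_uminus[OF two_sided_ideal_uea_ideal]
  by (simp_all add: two_sided_ideal_def)

lemma lookup_mult_empty_word:
  fixes a b :: tensor_alg
  shows "Poly_Mapping.lookup (a * b) 0 = Poly_Mapping.lookup a 0 * Poly_Mapping.lookup b 0"
proof -
  have eq: "(0 :: gword) = l + q \<longleftrightarrow> l = 0 \<and> q = 0" for l q
    by (cases l; cases q) (auto simp: zero_gword_def plus_gword_def)
  have inner: "(\<Sum>q. Poly_Mapping.lookup b q when (0 :: gword) = l + q)
      = (Poly_Mapping.lookup b 0 when l = 0)" for l
    by (cases "l = 0") (simp_all add: eq)
  show ?thesis
    by (simp only: lookup_mult inner mult_when Sum_any_when_equal)
qed

lemma lookup_tensor_of_empty_word: "Poly_Mapping.lookup (tensor_of x) 0 = 0"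
  by (simp add: tensor_of_def lookup_sum lookup_single zero_gword_def)

lemma one_notin_uea_ideal: "1 \<notin> uea_ideal"
proof -
  let ?A = "{a :: tensor_alg. Poly_Mapping.lookup a 0 = 0}"
  have "two_sided_ideal ?A"
    by (auto simp: two_sided_ideal_def lookup_mult_empty_word lookup_add)
  moreover have "uea_relations \<subseteq> ?A"
    by (auto simp: uea_relations_def lookup_minus lookup_mult_empty_word lookup_tensor_of_empty_word)
  moreover have "1 \<notin> ?A"
    by (simp add: lookup_one)
  ultimately show ?thesis
    unfolding uea_ideal_def by blast
qed

quotient_type uea = tensor_alg / "\<lambda>a b. a - b \<in> uea_ideal"
proof (rule equivpI)
  show "reflp (\<lambda>a b. a - b \<in> uea_ideal)"
    by (rule reflpI) (simp add: uea_ideal_zero)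
  show "symp (\<lambda>a b. a - b \<in> uea_ideal)"
    by (rule sympI) (use uea_ideal_uminus in fastforce)
  show "transp (\<lambda>a b. a - b \<in> uea_ideal)"
  proof (rule transpI)
    fix a b c :: tensor_alg
    assume "a - b \<in> uea_ideal" "b - c \<in> uea_ideal"
    from uea_ideal_add[OF this] show "a - c \<in> uea_ideal"
      by simp
  qed
qed

instantiation uea :: ring_1
begin
lift_definition zero_uea :: uea is 0 .
lift_definition one_uea :: uea is 1 .
lift_definition plus_uea :: "uea \<Rightarrow> uea \<Rightarrow> uea" is "(+)"
  by (metis add_diff_add uea_ideal_add)
lift_definition uminus_uea :: "uea \<Rightarrow> uea" is uminus
  by (metis minus_diff_minus uea_ideal_uminus)
lift_definition minus_uea :: "uea \<Rightarrow> uea \<Rightarrow> uea" is "(-)"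
proof -
  fix a b c d :: tensor_alg
  assume "a - b \<in> uea_ideal" "c - d \<in> uea_ideal"
  then have "(a - b) + - (c - d) \<in> uea_ideal"
    by (intro uea_ideal_add uea_ideal_uminus)
  then show "a - c - (b - d) \<in> uea_ideal"
    by (simp add: algebra_simps)
qed
lift_definition times_uea :: "uea \<Rightarrow> uea \<Rightarrow> uea" is "(*)"
proof -
  fix a b c d :: tensor_alg
  assume "a - b \<in> uea_ideal" "c - d \<in> uea_ideal"
  then have "(a - b) * c + b * (c - d) \<in> uea_ideal"
    by (intro uea_ideal_add uea_ideal_mult_left uea_ideal_mult_right)
  then show "a * c - b * d \<in> uea_ideal"
    by (simp add: algebra_simps)
qed
instance
proof
  fix a b c :: uea
  show "a + b + c = a + (b + c)"
    by transfer (simp only: add.assoc diff_self uea_ideal_zero)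
  show "a + b = b + a"
    by transfer (simp only: add.commute diff_self uea_ideal_zero)
  show "0 + a = a"
    by transfer (simp only: add_0_left diff_self uea_ideal_zero)
  show "- a + a = 0"
    by transfer (simp only: left_minus diff_self uea_ideal_zero)
  show "a - b = a + - b"
    by transfer (simp only: diff_conv_add_uminus right_minus uea_ideal_zero)
  show "a * b * c = a * (b * c)"
    by transfer (simp only: mult.assoc diff_self uea_ideal_zero)
  show "1 * a = a"
    by transfer (simp only: mult_1_left diff_self uea_ideal_zero)
  show "a * 1 = a"
    by transfer (simp only: mult_1_right diff_self uea_ideal_zero)
  show "(a + b) * c = a * c + b * c"
    by transfer (simp only: distrib_right diff_self uea_ideal_zero)
  show "a * (b + c) = a * b + a * c"
    by transfer (simp only: distrib_left diff_self uea_ideal_zero)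
  show "(0 :: uea) \<noteq> 1"
    by transfer (use one_notin_uea_ideal uea_ideal_uminus in force)
qed
end

lift_definition uea_of :: "schrodinger \<Rightarrow> uea" is tensor_of .

lift_definition uea_const :: "complex \<Rightarrow> uea" is "Poly_Mapping.single 0" .

lemma uea_of_lie_bracket: "uea_of (lie_bracket x y) = uea_of x * uea_of y - uea_of y * uea_of x"
proof transfer
  fix x y
  have "tensor_of x * tensor_of y - tensor_of y * tensor_of x - tensor_of (lie_bracket x y) \<in> uea_ideal"
    unfolding uea_ideal_def uea_relations_def by blast
  from uea_ideal_uminus[OF this]
  show "tensor_of (lie_bracket x y) - (tensor_of x * tensor_of y - tensor_of y * tensor_of x) \<in> uea_ideal"
    by simp
qed

abbreviation U_gen :: "gen \<Rightarrow> uea" where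
  "U_gen i \<equiv> uea_of (basis_vec i)"

definition C0 :: uea where
  "C0 = U_gen GP ^ 2 * U_gen GF - U_gen GQ ^ 2 * U_gen GE - U_gen GH * U_gen GP * U_gen GQ"

definition subalgebra :: "uea set \<Rightarrow> bool" where
  "subalgebra A \<longleftrightarrow>
     (\<forall>c. uea_const c \<in> A) \<and> (\<forall>a\<in>A. \<forall>b\<in>A. a + b \<in> A \<and> a * b \<in> A)"

definition alg_C0 :: "uea set" where
  "alg_C0 = \<Inter> {A. subalgebra A \<and> C0 \<in> A}"

definition poly_C0 :: "complex poly \<Rightarrow> uea" where
  "poly_C0 g = (\<Sum>i\<le>degree g. uea_const (coeff g i) * C0 ^ i)"

definition schrodinger_module ::
  "(complex \<Rightarrow> 'v \<Rightarrow> 'v) \<Rightarrow> (schrodinger \<Rightarrow> 'v \<Rightarrow> 'v::ab_group_add) \<Rightarrow> bool" where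
  "schrodinger_module smul \<rho> \<longleftrightarrow>
     vector_space smul \<and>
     (\<forall>v. Vector_Spaces.linear (*s) smul (\<lambda>x. \<rho> x v)) \<and>
     (\<forall>x. Vector_Spaces.linear smul smul (\<rho> x)) \<and>
     (\<forall>x y v. \<rho> (lie_bracket x y) v = \<rho> x (\<rho> y v) - \<rho> y (\<rho> x v))"

definition word_act :: "(schrodinger \<Rightarrow> 'v \<Rightarrow> 'v) \<Rightarrow> gword \<Rightarrow> 'v \<Rightarrow> 'v" where
  "word_act \<rho> u v = foldr (\<lambda>i. \<rho> (basis_vec i)) (letters u) v"

definition tensor_act ::
  "(complex \<Rightarrow> 'v \<Rightarrow> 'v) \<Rightarrow> (schrodinger \<Rightarrow> 'v \<Rightarrow> 'v::ab_group_add) \<Rightarrow> tensor_alg \<Rightarrow> 'v \<Rightarrow> 'v" where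
  "tensor_act smul \<rho> a v =
     (\<Sum>u\<in>Poly_Mapping.keys a. smul (Poly_Mapping.lookup a u) (word_act \<rho> u v))"

text \<open>The action of an element of the enveloping algebra is computed on a representative in the
  tensor algebra; for modules the choice is irrelevant by \<open>uea_act_abs\<close> below.\<close>

definition uea_act ::
  "(complex \<Rightarrow> 'v \<Rightarrow> 'v) \<Rightarrow> (schrodinger \<Rightarrow> 'v \<Rightarrow> 'v::ab_group_add) \<Rightarrow> uea \<Rightarrow> 'v \<Rightarrow> 'v" where
  "uea_act smul \<rho> a v = tensor_act smul \<rho> (rep_uea a) v"

locale schrodinger_mod =
  fixes smul :: "complex \<Rightarrow> 'v \<Rightarrow> 'v::ab_group_add" and \<rho> :: "schrodinger \<Rightarrow> 'v \<Rightarrow> 'v"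
  assumes module: "schrodinger_module smul \<rho>"
begin

lemma vs: "vector_space smul"
  and lin_left: "Vector_Spaces.linear (*s) smul (\<lambda>x. \<rho> x v)"
  and lin_right: "Vector_Spaces.linear smul smul (\<rho> x)"
  and act_bracket: "\<rho> (lie_bracket x y) v = \<rho> x (\<rho> y v) - \<rho> y (\<rho> x v)"
  using module by (auto simp: schrodinger_module_def)

sublocale V: vector_space smul
  by (rule vs)

sublocale R: Vector_Spaces.linear smul smul "\<rho> x" for x
  by (rule lin_right)

abbreviation "T \<equiv> tensor_act smul \<rho>"

lemma word_act_linear: "Vector_Spaces.linear smul smul (word_act \<rho> u)"
proof -
  have "Vector_Spaces.linear smul smul (foldr (\<lambda>i. \<rho> (basis_vec i)) xs)" for xs
  proof (induction xs)
    case Nil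
    then show ?case
      using V.linear_id by (simp add: id_def)
  next
    case (Cons i xs)
    then show ?case
      using Vector_Spaces.linear_compose[OF Cons.IH lin_right] by (simp add: o_def)
  qed
  then show ?thesis
    by (simp add: word_act_def[abs_def])
qed

sublocale W: Vector_Spaces.linear smul smul "word_act \<rho> u" for u
  by (rule word_act_linear)

lemma word_act_add: "word_act \<rho> (u + u') v = word_act \<rho> u (word_act \<rho> u' v)"
  by (simp add: word_act_def plus_gword_def)

lemma T_superset:
  assumes "finite S" "Poly_Mapping.keys a \<subseteq> S"
  shows "T a v = (\<Sum>u\<in>S. smul (Poly_Mapping.lookup a u) (word_act \<rho> u v))"
  unfolding tensor_act_def using assms
  by (intro sum.mono_neutral_left) (auto simp: in_keys_iff)

lemma T_add: "T (a + b) v = T a v + T b v"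
proof -
  let ?S = "Poly_Mapping.keys a \<union> Poly_Mapping.keys b"
  have "Poly_Mapping.keys (a + b) \<subseteq> ?S"
    by (rule Poly_Mapping.keys_add)
  then show ?thesis
    by (simp add: T_superset[of ?S] lookup_add V.scale_left_distrib sum.distrib)
qed

lemma T_zero: "T 0 v = 0"
  by (simp add: tensor_act_def)

lemma T_diff: "T (a - b) v = T a v - T b v"
  using T_add[of "a - b" b v] by simp

lemma T_sum: "T (sum f S) v = (\<Sum>i\<in>S. T (f i) v)"
  by (induction S rule: infinite_finite_induct) (simp_all add: T_zero T_add)

lemma T_single: "T (Poly_Mapping.single u c) v = smul c (word_act \<rho> u v)"
  by (cases "c = 0") (simp_all add: tensor_act_def)

lemma T_linear: "Vector_Spaces.linear smul smul (T a)"
  unfolding tensor_act_def[abs_def]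
  by unfold_locales
    (simp_all add: W.add W.scale V.scale_right_distrib sum.distrib V.scale_sum_right V.scale_left_commute
      mult.commute)

sublocale TL: Vector_Spaces.linear smul smul "T a" for a
  by (rule T_linear)

lemma tensor_expand: "(a :: tensor_alg) = (\<Sum>u\<in>Poly_Mapping.keys a. Poly_Mapping.single u (Poly_Mapping.lookup a u))"
  by (rule poly_mapping_eqI)
    (simp add: lookup_sum lookup_single when_def in_keys_iff)

lemma T_mult: "T (a * b) v = T a (T b v)"
proof -
  have 1: "T (Poly_Mapping.single u c * Poly_Mapping.single u' c') v
      = T (Poly_Mapping.single u c) (T (Poly_Mapping.single u' c') v)" for u u' c c'
    by (simp add: Poly_Mapping.mult_single T_single word_act_add W.scale)
  have 2: "T (Poly_Mapping.single u c * b) v = T (Poly_Mapping.single u c) (T b v)" for u c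
    by (subst (1 2) tensor_expand[of b]) (simp add: sum_distrib_left T_sum 1 TL.sum)
  show ?thesis
    by (subst (1 2) tensor_expand[of a]) (simp add: sum_distrib_right T_sum 2)
qed

lemma T_tensor_of: "T (tensor_of x) v = \<rho> x v"
proof -
  interpret L: Vector_Spaces.linear "(*s)" smul "\<lambda>x. \<rho> x v"
    by (rule lin_left)
  have "T (tensor_of x) v = (\<Sum>i\<in>UNIV. \<rho> (x $ i *s basis_vec i) v)"
    by (simp add: tensor_of_def T_sum T_single word_act_def L.scale)
  also have "\<dots> = \<rho> (\<Sum>i\<in>UNIV. x $ i *s basis_vec i) v"
    by (simp add: L.sum)
  also have "(\<Sum>i\<in>UNIV. x $ i *s basis_vec i) = x"
    by (rule basis_expansion)
  finally show ?thesis .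
qed

lemma T_uea_ideal:
  assumes "a \<in> uea_ideal"
  shows "T a v = 0"
proof -
  have "two_sided_ideal {a. \<forall>v. T a v = 0}"
    by (auto simp: two_sided_ideal_def T_zero T_add T_mult TL.zero)
  moreover have "uea_relations \<subseteq> {a. \<forall>v. T a v = 0}"
    by (auto simp: uea_relations_def T_diff T_mult T_tensor_of act_bracket)
  ultimately show ?thesis
    using assms unfolding uea_ideal_def by blast
qed

lemma uea_act_abs: "uea_act smul \<rho> (abs_uea a) v = T a v"
proof -
  have "rep_uea (abs_uea a) - a \<in> uea_ideal"
    by (metis Quotient3_uea rep_abs_rsp_left uea_ideal_zero diff_self)
  from T_uea_ideal[OF this, of v] show ?thesis
    by (simp add: uea_act_def T_diff)
qed

lemma uea_act_uea_of: "uea_act smul \<rho> (uea_of x) v = \<rho> x v"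
  by (simp add: uea_of.abs_eq uea_act_abs T_tensor_of)

lemma uea_act_const: "uea_act smul \<rho> (uea_const c) v = smul c v"
  by (simp add: uea_const.abs_eq uea_act_abs T_single word_act_def zero_gword_def)

lemma uea_act_add: "uea_act smul \<rho> (a + b) v = uea_act smul \<rho> a v + uea_act smul \<rho> b v"
  by (induction a; induction b) (simp add: plus_uea.abs_eq uea_act_abs T_add)

lemma uea_act_mult: "uea_act smul \<rho> (a * b) v = uea_act smul \<rho> a (uea_act smul \<rho> b v)"
  by (induction a; induction b) (simp add: times_uea.abs_eq uea_act_abs T_mult)

end

text \<open>In all that follows, the ambient module is the whole type \<open>'v\<close>, and its submodules are
  subsets of it.\<close>

definition submodule ::
  "(complex \<Rightarrow> 'v \<Rightarrow> 'v) \<Rightarrow> (schrodinger \<Rightarrow> 'v \<Rightarrow> 'v::ab_group_add) \<Rightarrow> 'v set \<Rightarrow> bool" where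
  "submodule smul \<rho> N \<longleftrightarrow>
     0 \<in> N \<and> (\<forall>x\<in>N. \<forall>y\<in>N. x + y \<in> N) \<and> (\<forall>c. \<forall>x\<in>N. smul c x \<in> N) \<and>
     (\<forall>s. \<forall>x\<in>N. \<rho> s x \<in> N)"

definition cyclic_submodule ::
  "(complex \<Rightarrow> 'v \<Rightarrow> 'v) \<Rightarrow> (schrodinger \<Rightarrow> 'v \<Rightarrow> 'v::ab_group_add) \<Rightarrow> 'v \<Rightarrow> 'v set" where
  "cyclic_submodule smul \<rho> v = {uea_act smul \<rho> a v | a. True}"

definition maximal_submodule ::
  "(complex \<Rightarrow> 'v \<Rightarrow> 'v) \<Rightarrow> (schrodinger \<Rightarrow> 'v \<Rightarrow> 'v::ab_group_add) \<Rightarrow> 'v set \<Rightarrow> bool" where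
  "maximal_submodule smul \<rho> N \<longleftrightarrow>
     submodule smul \<rho> N \<and> N \<noteq> UNIV \<and>
     (\<forall>L. submodule smul \<rho> L \<longrightarrow> N \<subseteq> L \<longrightarrow> L = N \<or> L = UNIV)"

definition simple_submodule ::
  "(complex \<Rightarrow> 'v \<Rightarrow> 'v) \<Rightarrow> (schrodinger \<Rightarrow> 'v \<Rightarrow> 'v::ab_group_add) \<Rightarrow> 'v set \<Rightarrow> bool" where
  "simple_submodule smul \<rho> M \<longleftrightarrow>
     submodule smul \<rho> M \<and> M \<noteq> {0} \<and>
     (\<forall>L. submodule smul \<rho> L \<longrightarrow> L \<subseteq> M \<longrightarrow> L = {0} \<or> L = M)"

definition internal_direct_sum :: "'i set \<Rightarrow> ('i \<Rightarrow> 'v set) \<Rightarrow> 'v::ab_group_add set \<Rightarrow> bool" where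
  "internal_direct_sum I N M \<longleftrightarrow>
     (\<forall>i\<in>I. N i \<subseteq> M) \<and> (\<forall>v\<in>M. \<exists>!f. f \<in> (\<Pi>\<^sub>E i\<in>I. N i) \<and> v = (\<Sum>i\<in>I. f i))"

definition indecomposable ::
  "(complex \<Rightarrow> 'v \<Rightarrow> 'v) \<Rightarrow> (schrodinger \<Rightarrow> 'v \<Rightarrow> 'v::ab_group_add) \<Rightarrow> 'v set \<Rightarrow> bool" where
  "indecomposable smul \<rho> M \<longleftrightarrow>
     submodule smul \<rho> M \<and> M \<noteq> {0} \<and>
     \<not> (\<exists>A B. submodule smul \<rho> A \<and> submodule smul \<rho> B \<and> A \<noteq> {0} \<and> B \<noteq> {0} \<and>
            M = {a + b | a b. a \<in> A \<and> b \<in> B} \<and> A \<inter> B = {0})"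

definition add_coset :: "'v::ab_group_add \<Rightarrow> 'v set \<Rightarrow> 'v set" where
  "add_coset x N = {x + y | y. y \<in> N}"

definition quotient_carrier :: "'v::ab_group_add set \<Rightarrow> 'v set \<Rightarrow> 'v set set" where
  "quotient_carrier M N = {add_coset x N | x. x \<in> M}"

text \<open>A set \<open>Q\<close> of cosets is a submodule of \<open>M/N\<close> if it is closed under the operations of the
  quotient module, which are computed on representatives.\<close>

definition quotient_submodule ::
  "(complex \<Rightarrow> 'v \<Rightarrow> 'v) \<Rightarrow> (schrodinger \<Rightarrow> 'v \<Rightarrow> 'v::ab_group_add) \<Rightarrow> 'v set \<Rightarrow> 'v set
     \<Rightarrow> 'v set set \<Rightarrow> bool" where
  "quotient_submodule smul \<rho> M N Q \<longleftrightarrow>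
     Q \<subseteq> quotient_carrier M N \<and> add_coset 0 N \<in> Q \<and>
     (\<forall>x\<in>M. \<forall>y\<in>M. add_coset x N \<in> Q \<longrightarrow> add_coset y N \<in> Q \<longrightarrow> add_coset (x + y) N \<in> Q) \<and>
     (\<forall>c. \<forall>x\<in>M. add_coset x N \<in> Q \<longrightarrow> add_coset (smul c x) N \<in> Q) \<and>
     (\<forall>s. \<forall>x\<in>M. add_coset x N \<in> Q \<longrightarrow> add_coset (\<rho> s x) N \<in> Q)"

definition simple_quotient ::
  "(complex \<Rightarrow> 'v \<Rightarrow> 'v) \<Rightarrow> (schrodinger \<Rightarrow> 'v \<Rightarrow> 'v::ab_group_add) \<Rightarrow> 'v set \<Rightarrow> 'v set
     \<Rightarrow> bool" where
  "simple_quotient smul \<rho> M N \<longleftrightarrow>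
     quotient_carrier M N \<noteq> {add_coset 0 N} \<and>
     (\<forall>Q. quotient_submodule smul \<rho> M N Q \<longrightarrow> Q = {add_coset 0 N} \<or> Q = quotient_carrier M N)"

definition composition_series ::
  "(complex \<Rightarrow> 'v \<Rightarrow> 'v) \<Rightarrow> (schrodinger \<Rightarrow> 'v \<Rightarrow> 'v::ab_group_add) \<Rightarrow> 'v set \<Rightarrow> nat
     \<Rightarrow> (nat \<Rightarrow> 'v set) \<Rightarrow> bool" where
  "composition_series smul \<rho> M n N \<longleftrightarrow>
     N 0 = {0} \<and> N n = M \<and> (\<forall>i\<le>n. submodule smul \<rho> (N i)) \<and>
     (\<forall>i<n. N i \<subseteq> N (Suc i) \<and> simple_quotient smul \<rho> (N (Suc i)) (N i))"

definition has_composition_length ::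
  "(complex \<Rightarrow> 'v \<Rightarrow> 'v) \<Rightarrow> (schrodinger \<Rightarrow> 'v \<Rightarrow> 'v::ab_group_add) \<Rightarrow> 'v set \<Rightarrow> nat \<Rightarrow> bool" where
  "has_composition_length smul \<rho> M n \<longleftrightarrow>
     (\<exists>N. composition_series smul \<rho> M n N) \<and>
     (\<forall>m N. composition_series smul \<rho> M m N \<longrightarrow> m = n)"

definition quasi_whittaker_vector ::
  "(complex \<Rightarrow> 'v \<Rightarrow> 'v) \<Rightarrow> (schrodinger \<Rightarrow> 'v \<Rightarrow> 'v::ab_group_add) \<Rightarrow> (schrodinger \<Rightarrow> complex)
     \<Rightarrow> 'v \<Rightarrow> bool" where
  "quasi_whittaker_vector smul \<rho> \<phi> v \<longleftrightarrow>
     v \<noteq> 0 \<and> (\<forall>x\<in>heisenberg. \<rho> x v = smul (\<phi> x) v)"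

definition quasi_whittaker_module ::
  "(complex \<Rightarrow> 'v \<Rightarrow> 'v) \<Rightarrow> (schrodinger \<Rightarrow> 'v \<Rightarrow> 'v::ab_group_add) \<Rightarrow> (schrodinger \<Rightarrow> complex)
     \<Rightarrow> 'v set \<Rightarrow> 'v \<Rightarrow> bool" where
  "quasi_whittaker_module smul \<rho> \<phi> M v \<longleftrightarrow>
     submodule smul \<rho> M \<and> v \<in> M \<and> quasi_whittaker_vector smul \<rho> \<phi> v \<and>
     M = cyclic_submodule smul \<rho> v"

definition ann_C0 ::
  "(complex \<Rightarrow> 'v \<Rightarrow> 'v) \<Rightarrow> (schrodinger \<Rightarrow> 'v \<Rightarrow> 'v::ab_group_add) \<Rightarrow> 'v \<Rightarrow> uea set" where
  "ann_C0 smul \<rho> w = {a \<in> alg_C0. uea_act smul \<rho> a w = 0}"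

definition monic_generator :: "complex poly \<Rightarrow> uea set \<Rightarrow> bool" where
  "monic_generator d I \<longleftrightarrow> lead_coeff d = 1 \<and> I = {poly_C0 d * a | a. a \<in> alg_C0}"

end

theory Submission
  imports Defs "HOL-Library.Function_Algebras"
    "HOL-Computational_Algebra.Fundamental_Theorem_Algebra"
begin

text \<open>
  A homomorphism from the Heisenberg algebra to the complex numbers kills \<open>z = [p,q]\<close>, and \<open>z\<close> is
  central, so \<open>z\<close> acts by zero on \<open>V\<close>. Modulo \<open>z\<close> the element \<open>C\<^sub>0\<close> commutes with everything, and
  each polynomial \<open>g(C\<^sub>0)\<close> acts on \<open>V\<close> by a module endomorphism whose image is the submodule
  generated by \<open>g(C\<^sub>0) w\<close>.

  The heart of the matter is that every submodule \<open>N\<close> of \<open>V\<close> is generated by the vectors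
  \<open>g(C\<^sub>0) w\<close> that it contains (\<open>submodule_le\<close>). Suppose that \<open>p w = \<mu> w\<close> with \<open>\<mu> \<noteq> 0\<close> and
  \<open>q w = \<nu> w\<close>. Then \<open>f\<close> can be eliminated with the help of \<open>C\<^sub>0\<close>, and \<open>V\<close> is spanned by the
  vectors \<open>h\<^sup>i e\<^sup>j g(C\<^sub>0) w\<close>. Up to a nonzero factor and terms of lower degree, \<open>p - \<mu>\<close>
  differentiates with respect to \<open>h\<close> and, on vectors without \<open>h\<close>, \<open>q - \<nu>\<close> differentiates with
  respect to \<open>e\<close>. Since \<open>N\<close> is stable under both, the coefficients of each of its vectors lie in
  \<open>N\<close> as well (\<open>lowering_coefficients\<close>). The case \<open>\<mu> = 0\<close>, \<open>\<nu> \<noteq> 0\<close> follows by an automorphism of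
  the algebra.

  Consequently submodules correspond to ideals of polynomials containing the generator \<open>d\<close> of the
  annihilator of \<open>w\<close>: they are the images of \<open>g(C\<^sub>0)\<close> for the divisors \<open>g\<close> of \<open>d\<close>
  (\<open>submodule_eq_range\<close>), and inclusion of submodules is divisibility reversed
  (\<open>range_central_act_le_iff\<close>). Reading the hypothesis on the annihilator as a statement on
  polynomials requires \<open>C\<^sub>0\<close> to be transcendental, which is checked on explicit modules where
  \<open>C\<^sub>0\<close> acts by any prescribed scalar (\<open>poly_C0_eq_0_iff\<close>).

  Everything else is arithmetic of divisors of \<open>d\<close>. Maximal submodules belong to the linear
  factors. A subquotient is simple exactly when the degree of the divisor drops by one, so that
  composition lengths are differences of degrees. The submodules of \<open>V\<^sub>j\<close> belong to the powers of
  a single linear factor, and the smallest nonzero one is contained in all others, so \<open>V\<^sub>j\<close> is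
  indecomposable. The polynomials \<open>d\<^sub>j\<close> have no common root, and a Bezout identity between them
  splits \<open>V\<close> into the direct sum.
\<close>

section \<open>Invariant subspaces and lowering operators\<close>

locale complex_space = vector_space scale
  for scale :: "complex \<Rightarrow> 'b \<Rightarrow> 'b::ab_group_add"
begin

definition tower :: "('b \<Rightarrow> 'b) \<Rightarrow> 'b set \<Rightarrow> nat \<Rightarrow> 'b set" where
  "tower T Y n = span (\<Union>i<n. (T ^^ i) ` Y)"

definition hull_under :: "('b \<Rightarrow> 'b) \<Rightarrow> 'b set \<Rightarrow> 'b set" where
  "hull_under T Y = span (\<Union>i. (T ^^ i) ` Y)"

lemma linear_funpow:
  assumes "Vector_Spaces.linear scale scale T"
  shows "Vector_Spaces.linear scale scale (T ^^ n)"
  using assms by (induction n) (auto simp: linear_id intro: Vector_Spaces.linear_compose)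

lemma subspace_tower: "subspace (tower T Y n)"
  unfolding tower_def by (rule subspace_span)

lemma subspace_hull_under: "subspace (hull_under T Y)"
  unfolding hull_under_def by (rule subspace_span)

lemma tower_0: "tower T Y 0 = {0}"
  by (simp add: tower_def)

lemma tower_mono: "m \<le> n \<Longrightarrow> tower T Y m \<subseteq> tower T Y n"
  unfolding tower_def by (intro span_mono UN_mono) auto

lemma funpow_in_tower: "y \<in> Y \<Longrightarrow> i < n \<Longrightarrow> (T ^^ i) y \<in> tower T Y n"
  unfolding tower_def by (intro span_base) auto

lemma funpow_in_hull_under: "y \<in> Y \<Longrightarrow> (T ^^ i) y \<in> hull_under T Y"
  unfolding hull_under_def by (intro span_base) auto

lemma base_in_hull_under: "y \<in> Y \<Longrightarrow> y \<in> hull_under T Y"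
  using funpow_in_hull_under[where i = 0] by simp

lemma hull_under_least:
  assumes "subspace H" "Y \<subseteq> H" "\<And>x. x \<in> H \<Longrightarrow> T x \<in> H"
  shows "hull_under T Y \<subseteq> H"
proof -
  have "(T ^^ i) y \<in> H" if "y \<in> Y" for i y
    using that assms(2,3) by (induction i) auto
  then show ?thesis
    unfolding hull_under_def by (intro span_minimal assms(1)) auto
qed

lemma funpow_in_closed: "(\<And>x. x \<in> H \<Longrightarrow> T x \<in> H) \<Longrightarrow> y \<in> H \<Longrightarrow> (T ^^ i) y \<in> H"
  by (induction i) auto

lemma linear_maps_span:
  assumes "Vector_Spaces.linear scale scale D" "subspace H" "\<And>x. x \<in> S \<Longrightarrow> D x \<in> H" "x \<in> span S"
  shows "D x \<in> H"
proof -
  interpret D: Vector_Spaces.linear scale scale D by fact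
  from assms(4) show ?thesis
    by (rule span_induct)
      (auto intro!: D.subspace_vimage[unfolded vimage_def] assms simp: )
qed

text \<open>The towers filter \<^term>\<open>hull_under T Y\<close> by the degree in \<^term>\<open>T\<close>, so that one can argue by leading
  terms although the powers of \<^term>\<open>T\<close> are not assumed to be independent over \<^term>\<open>Y\<close>.\<close>

lemma tower_step:
  assumes "Vector_Spaces.linear scale scale T" "x \<in> tower T Y n"
  shows "T x \<in> tower T Y (Suc n)"
  using assms(1) subspace_tower _ assms(2)[unfolded tower_def]
proof (rule linear_maps_span)
  fix x assume "x \<in> (\<Union>i<n. (T ^^ i) ` Y)"
  then obtain i y where "i < n" "y \<in> Y" "x = (T ^^ i) y" by auto
  then show "T x \<in> tower T Y (Suc n)"
    using funpow_in_tower[where i = "Suc i" and n = "Suc n"] by simp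
qed

lemma hull_under_step:
  assumes "Vector_Spaces.linear scale scale T" "x \<in> hull_under T Y"
  shows "T x \<in> hull_under T Y"
  using assms(1) subspace_hull_under _ assms(2)[unfolded hull_under_def]
proof (rule linear_maps_span)
  fix x assume "x \<in> (\<Union>i. (T ^^ i) ` Y)"
  then obtain i y where "y \<in> Y" "x = (T ^^ i) y" by auto
  then show "T x \<in> hull_under T Y"
    using funpow_in_hull_under[where i = "Suc i"] by simp
qed

lemma hull_under_eq_tower: "x \<in> hull_under T Y \<Longrightarrow> \<exists>n. x \<in> tower T Y n"
  unfolding hull_under_def
proof (induction rule: span_induct_alt)
  case base
  then show ?case using tower_0 by blast
next
  case (step c x y)
  then obtain i u n where "u \<in> Y" "x = (T ^^ i) u" "y \<in> tower T Y n" by auto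
  then have "x \<in> tower T Y (max (Suc i) n)" "y \<in> tower T Y (max (Suc i) n)"
    using tower_mono[of n "max (Suc i) n" T Y] by (auto intro: funpow_in_tower)
  then show ?case
    using subspace_tower subspace_add subspace_scale by metis
qed

lemma tower_Suc_decompose:
  assumes T: "Vector_Spaces.linear scale scale T" and Y: "subspace Y" and v: "v \<in> tower T Y (Suc n)"
  obtains x y where "x \<in> tower T Y n" "y \<in> Y" "v = x + (T ^^ n) y"
proof -
  interpret P: Vector_Spaces.linear scale scale "T ^^ n" by (rule linear_funpow[OF T])
  have "span ((T ^^ n) ` Y) = (T ^^ n) ` Y"
    using P.subspace_image[OF Y] by (simp only: span_eq_iff)
  moreover have "tower T Y (Suc n) = span ((\<Union>i<n. (T ^^ i) ` Y) \<union> (T ^^ n) ` Y)"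
    unfolding tower_def by (simp add: lessThan_Suc Un_commute)
  ultimately have "tower T Y (Suc n) = {x + y | x y. x \<in> tower T Y n \<and> y \<in> (T ^^ n) ` Y}"
    by (simp only: span_Un tower_def)
  then show ?thesis
    using v that by blast
qed

text \<open>The relation makes \<open>D\<close> a lowering operator: it sends \<open>T\<^sup>n y\<close> to \<open>- n \<mu> T\<^bsup>n-1\<^esup> y\<close> up to terms
  of smaller degree in \<open>T\<close>. Applying \<open>D\<close> repeatedly to a vector of \<open>N\<close> therefore isolates a
  nonzero multiple of its leading coefficient, which must lie in \<open>N\<close>; subtracting the leading term
  and iterating puts all coefficients into \<open>N\<close>. The set \<open>H\<close> is there because in the second
  application below the relation holds only on an eigenspace.\<close>

lemma lowering_coefficients:
  assumes T: "Vector_Spaces.linear scale scale T" and D: "Vector_Spaces.linear scale scale D"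
    and H: "\<And>x. x \<in> H \<Longrightarrow> T x \<in> H" and Y: "subspace Y" "Y \<subseteq> H"
    and DY: "\<And>y. y \<in> Y \<Longrightarrow> D y = 0"
    and rel: "\<And>x. x \<in> H \<Longrightarrow> D (T x) = T (D x) - scale s (D x) - scale \<mu> x"
    and \<mu>: "\<And>n. of_nat (Suc n) * \<mu> \<noteq> 0"
    and N: "subspace N" "\<And>x. x \<in> N \<Longrightarrow> T x \<in> N" "\<And>x. x \<in> N \<Longrightarrow> D x \<in> N"
    and v: "v \<in> N" "v \<in> hull_under T Y"
  shows "v \<in> hull_under T (N \<inter> Y)"
proof -
  interpret T: Vector_Spaces.linear scale scale T by fact
  interpret D: Vector_Spaces.linear scale scale D by fact
  note sub = subspace_add[OF subspace_tower] subspace_diff[OF subspace_tower]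
    subspace_scale[OF subspace_tower] subspace_neg[OF subspace_tower]
  have lead: "D ((T ^^ Suc n) y) + scale (of_nat (Suc n) * \<mu>) ((T ^^ n) y) \<in> tower T Y n"
    if y: "y \<in> Y" for n y
  proof (induction n)
    case 0
    then show ?case
      using rel[of y] DY[OF y] Y y by (auto simp: tower_0 T.zero)
  next
    case (Suc n)
    let ?x = "(T ^^ Suc n) y" and ?u = "(T ^^ n) y"
    define c where "c = of_nat (Suc n) * \<mu>"
    define r where "r = D ?x + scale c ?u"
    have r: "r \<in> tower T Y n" using Suc r_def c_def by simp
    have Dx: "D ?x = r - scale c ?u" by (simp add: r_def)
    have c': "of_nat (Suc (Suc n)) * \<mu> = c + \<mu>" by (simp add: c_def algebra_simps)
    have "?x \<in> H" using funpow_in_closed[where T = T and H = H, OF H] y Y by blast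
    then have "D (T ?x) = T (D ?x) - scale s (D ?x) - scale \<mu> ?x" by (rule rel)
    then have "D (T ?x) + scale (of_nat (Suc (Suc n)) * \<mu>) ?x
        = T r - scale s r + scale (s * c) ?u"
      unfolding Dx c' by (simp add: T.diff T.scale algebra_simps)
    moreover have "\<dots> \<in> tower T Y (Suc n)"
      using tower_step[OF T r] r tower_mono[of n "Suc n"] y
      by (intro sub) (auto intro: funpow_in_tower)
    ultimately show ?case by simp
  qed
  have lower: "D x \<in> tower T Y n" if x: "x \<in> tower T Y (Suc n)" for x n
    using D subspace_tower _ x[unfolded tower_def]
  proof (rule linear_maps_span)
    fix x assume "x \<in> (\<Union>i<Suc n. (T ^^ i) ` Y)"
    then obtain i y where i: "i < Suc n" "y \<in> Y" "x = (T ^^ i) y" by auto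
    show "D x \<in> tower T Y n"
    proof (cases i)
      case 0
      then show ?thesis using i DY subspace_0[OF subspace_tower] by simp
    next
      case (Suc j)
      have "D x + scale (of_nat (Suc j) * \<mu>) ((T ^^ j) y) \<in> tower T Y n"
        using lead[OF \<open>y \<in> Y\<close>, of j] i Suc tower_mono[of j n T Y] by auto
      moreover have "(T ^^ j) y \<in> tower T Y n"
        using i Suc by (intro funpow_in_tower) auto
      ultimately show ?thesis
        using sub(2)[OF _ sub(3)] by (metis add_diff_cancel_right')
    qed
  qed
  have top: "y \<in> N" if "c \<noteq> 0" "y \<in> Y" "v \<in> N" "v - scale c ((T ^^ m) y) \<in> tower T Y m" for c y v m
    using that
  proof (induction m arbitrary: c v)
    case 0
    then have "v = scale c y" by (simp add: tower_0)
    then have "y = scale (inverse c) v" using \<open>c \<noteq> 0\<close> by simp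
    then show ?case using subspace_scale[OF N(1) \<open>v \<in> N\<close>] by simp
  next
    case (Suc m)
    let ?c = "- (c * (of_nat (Suc m) * \<mu>))"
    have "D v - scale c (D ((T ^^ Suc m) y)) \<in> tower T Y m"
      using lower[OF Suc.prems(4)] by (simp add: D.diff D.scale)
    from sub(1)[OF this sub(3)[OF lead[OF \<open>y \<in> Y\<close>, of m], of c]]
    have "D v - scale ?c ((T ^^ m) y) \<in> tower T Y m"
      by (simp add: scale_right_distrib)
    moreover have "?c \<noteq> 0" using \<mu> \<open>c \<noteq> 0\<close> by simp
    ultimately show ?case
      using Suc.IH[of ?c "D v"] Suc.prems N(3) by blast
  qed
  have "v \<in> hull_under T (N \<inter> Y)" if "v \<in> N" "v \<in> tower T Y n" for v n
    using that
  proof (induction n arbitrary: v)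
    case 0
    then show ?case using subspace_0[OF subspace_hull_under] by (simp add: tower_0)
  next
    case (Suc n)
    obtain x y where xy: "x \<in> tower T Y n" "y \<in> Y" "v = x + (T ^^ n) y"
      using tower_Suc_decompose[OF T Y(1) Suc.prems(2)] .
    have "y \<in> N" by (rule top[of 1 y v n]) (use xy Suc.prems in auto)
    then have "(T ^^ n) y \<in> N" by (intro funpow_in_closed[where T = T and H = N] N(2))
    then have "x \<in> N" using xy subspace_diff[OF N(1) Suc.prems(1)] by fastforce
    then show ?case
      using Suc.IH xy \<open>y \<in> N\<close>
      by (auto intro!: subspace_add[OF subspace_hull_under] funpow_in_hull_under)
  qed
  then show ?thesis using v hull_under_eq_tower by blast
qed

end

section \<open>Modules on which the central element z vanishes\<close>

text \<open>The defining relations of the Schroedinger algebra modulo \<open>z\<close>, oriented so that as rewrite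
  rules they bring every operator word into the order \<open>h, e, f, p, q\<close>, with \<open>h\<close> leftmost.\<close>

locale schrodinger_operators = complex_space smul
  for smul :: "complex \<Rightarrow> 'v \<Rightarrow> 'v::ab_group_add" +
  fixes e h f p q :: "'v \<Rightarrow> 'v"
  assumes lin_e: "Vector_Spaces.linear smul smul e" and lin_h: "Vector_Spaces.linear smul smul h"
    and lin_f: "Vector_Spaces.linear smul smul f" and lin_p: "Vector_Spaces.linear smul smul p"
    and lin_q: "Vector_Spaces.linear smul smul q"
    and eh: "e (h x) = h (e x) - (e x + e x)" and fh: "f (h x) = h (f x) + (f x + f x)"
    and ph: "p (h x) = h (p x) - p x" and qh: "q (h x) = h (q x) + q x"
    and fe: "f (e x) = e (f x) - h x" and pe: "p (e x) = e (p x)" and qe: "q (e x) = e (q x) - p x"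
    and pf: "p (f x) = f (p x) - q x" and qf: "q (f x) = f (q x)" and qp: "q (p x) = p (q x)"
begin

sublocale E: Vector_Spaces.linear smul smul e by (rule lin_e)
sublocale H: Vector_Spaces.linear smul smul h by (rule lin_h)
sublocale F: Vector_Spaces.linear smul smul f by (rule lin_f)
sublocale P: Vector_Spaces.linear smul smul p by (rule lin_p)
sublocale Q: Vector_Spaces.linear smul smul q by (rule lin_q)

definition stable :: "'v set \<Rightarrow> bool" where
  "stable N \<longleftrightarrow> subspace N \<and> (\<forall>x\<in>N. e x \<in> N \<and> h x \<in> N \<and> f x \<in> N \<and> p x \<in> N \<and> q x \<in> N)"

definition casimir :: "'v \<Rightarrow> 'v" where
  "casimir x = p (p (f x)) - q (q (e x)) - h (p (q x))"

lemmas op_simps = eh fh ph qh fe pe qe pf qf qp E.add E.diff E.neg H.add H.diff H.neg F.add F.diff F.neg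
  P.add P.diff P.neg Q.add Q.diff Q.neg

fun op_of :: "gen \<Rightarrow> 'v \<Rightarrow> 'v" where
  "op_of GE = e" | "op_of GH = h" | "op_of GF = f" | "op_of GP = p" | "op_of GQ = q"
| "op_of GZ = (\<lambda>x. 0)"

text \<open>The module that the operators define, on which \<open>z\<close> acts by zero.\<close>

definition combined_action :: "schrodinger \<Rightarrow> 'v \<Rightarrow> 'v" where
  "combined_action s x = (\<Sum>i\<in>UNIV. smul (s $ i) (op_of i x))"

lemma linear_op_of: "Vector_Spaces.linear smul smul (op_of i)"
proof -
  have "Vector_Spaces.linear smul smul (\<lambda>x. 0)"
    by unfold_locales simp_all
  then show ?thesis
    by (cases i) (simp_all add: lin_e lin_h lin_f lin_p lin_q)
qed

lemma combined_action_basis: "combined_action (basis_vec i) x = op_of i x"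
  by (cases i) (simp_all add: combined_action_def gen_sum axis_def)

lemma linear_combined_action_left: "Vector_Spaces.linear (*s) smul (\<lambda>s. combined_action s x)"
  by unfold_locales
    (simp_all add: combined_action_def scale_left_distrib sum.distrib scale_sum_right)

lemma linear_combined_action_right: "Vector_Spaces.linear smul smul (combined_action s)"
proof -
  interpret O: Vector_Spaces.linear smul smul "op_of i" for i by (rule linear_op_of)
  show ?thesis
    by unfold_locales
      (simp_all add: combined_action_def O.add O.scale scale_right_distrib sum.distrib
        scale_sum_right mult.commute)
qed

lemma op_of_commutator:
  "combined_action (base_bracket i j - base_bracket j i) x = op_of i (op_of j x) - op_of j (op_of i x)"
proof -
  interpret L: Vector_Spaces.linear "(*s)" smul "\<lambda>s. combined_action s x"
    by (rule linear_combined_action_left)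
  have two: "smul 2 y = y + y" for y
    using scale_left_distrib[of 1 1 y] by simp
  show ?thesis
    by (cases i; cases j)
      (simp_all add: L.diff L.neg L.scale L.zero combined_action_basis two op_simps
        E.zero H.zero F.zero P.zero Q.zero)
qed

lemma combined_action_module: "schrodinger_mod smul combined_action"
proof
  interpret O: Vector_Spaces.linear smul smul "op_of i" for i by (rule linear_op_of)
  interpret L: Vector_Spaces.linear "(*s)" smul "\<lambda>s. combined_action s v" for v
    by (rule linear_combined_action_left)
  have "combined_action (lie_bracket x y) v
      = combined_action x (combined_action y v) - combined_action y (combined_action x v)" for x y v
  proof -
    have "combined_action (lie_bracket x y) v
        = (\<Sum>i\<in>UNIV. \<Sum>j\<in>UNIV. smul (x $ i * y $ j) (op_of i (op_of j v) - op_of j (op_of i v)))"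
      by (simp only: lie_bracket_def L.sum L.scale op_of_commutator)
    also have "\<dots> = (\<Sum>i\<in>UNIV. \<Sum>j\<in>UNIV. smul (x $ i) (smul (y $ j) (op_of i (op_of j v))))
        - (\<Sum>j\<in>UNIV. \<Sum>i\<in>UNIV. smul (y $ j) (smul (x $ i) (op_of j (op_of i v))))"
      by (subst (2) sum.swap) (simp add: scale_right_diff_distrib sum_subtractf mult.commute)
    finally show ?thesis
      by (simp add: combined_action_def O.sum O.scale scale_sum_right)
  qed
  moreover have "vector_space smul"
    by unfold_locales
  ultimately show "schrodinger_module smul combined_action"
    unfolding schrodinger_module_def
    using linear_combined_action_left linear_combined_action_right by blast
qed

lemma uea_act_C0: "uea_act smul combined_action C0 x = casimir x"
proof -
  interpret M: schrodinger_mod smul combined_action by (rule combined_action_module)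
  have diff: "uea_act smul combined_action (a - b) v
      = uea_act smul combined_action a v - uea_act smul combined_action b v" for a b v
    using M.uea_act_add[of "a - b" b v] by simp
  have "combined_action (basis_vec GE) v = e v" "combined_action (basis_vec GH) v = h v"
    "combined_action (basis_vec GF) v = f v" "combined_action (basis_vec GP) v = p v"
    "combined_action (basis_vec GQ) v = q v" for v
    by (simp_all add: combined_action_basis)
  then show ?thesis
    by (simp only: C0_def power2_eq_square diff M.uea_act_mult M.uea_act_uea_of casimir_def)
qed

lemma casimir_commute:
  "casimir (e x) = e (casimir x)" "casimir (h x) = h (casimir x)" "casimir (f x) = f (casimir x)"
  "casimir (p x) = p (casimir x)" "casimir (q x) = q (casimir x)"
  by (simp_all add: casimir_def op_simps)

text \<open>An operator that commutes with \<open>T\<close> up to a shift \<open>T \<mapsto> T + s\<close> moves past all powers of \<open>T\<close>,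
  so its behaviour on \<open>U\<close> controls it on the whole hull.\<close>

lemma shifted_maps_hull:
  assumes X: "Vector_Spaces.linear smul smul X" and T: "Vector_Spaces.linear smul smul T"
    and rel: "\<And>x. X (T x) = T (X x) + smul s (X x)"
    and base: "\<And>u. u \<in> U \<Longrightarrow> X u \<in> hull_under T U"
    and x: "x \<in> hull_under T U"
  shows "X x \<in> hull_under T U"
proof -
  interpret X: Vector_Spaces.linear smul smul X by fact
  have "hull_under T U \<subseteq> {x. X x \<in> hull_under T U}"
    by (rule hull_under_least)
      (use X.subspace_vimage[OF subspace_hull_under] base hull_under_step[OF T] in
        \<open>auto simp: vimage_def rel intro!: subspace_add[OF subspace_hull_under]
          subspace_scale[OF subspace_hull_under]\<close>)
  then show ?thesis using x by auto
qed

text \<open>If \<open>p\<close> acts on \<open>Y\<close> by a nonzero scalar, then the formula for the Casimir element can be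
  solved for \<open>f\<close>, and hence the whole module is spanned by the vectors \<open>h\<^sup>i e\<^sup>j y\<close>. On
  \<open>hull_under e Y\<close> the operator \<open>p - \<mu>\<close> vanishes and it lowers the degree in \<open>h\<close>; on \<open>Y\<close> the
  operator \<open>q - \<nu>\<close> vanishes and it lowers the degree in \<open>e\<close>. Two applications of the lowering
  argument show that a submodule is determined by the vectors of \<open>Y\<close> that it contains.\<close>

lemma stable_le_by_eigenvectors_p:
  assumes \<mu>: "\<mu> \<noteq> 0" and Y: "subspace Y"
    and pY: "\<And>y. y \<in> Y \<Longrightarrow> p y = smul \<mu> y" and qY: "\<And>y. y \<in> Y \<Longrightarrow> q y = smul \<nu> y"
    and CY: "\<And>y. y \<in> Y \<Longrightarrow> casimir y \<in> Y"
    and gen: "\<And>M. stable M \<Longrightarrow> Y \<subseteq> M \<Longrightarrow> M = UNIV"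
    and N: "stable N" and L: "stable L" and NL: "N \<inter> Y \<subseteq> L"
  shows "N \<subseteq> L"
proof -
  define U where "U = hull_under e Y"
  define M where "M = hull_under h U"
  note subU = subspace_hull_under[of e Y, folded U_def]
  note subM = subspace_hull_under[of h U, folded M_def]
  have YU: "y \<in> U" if "y \<in> Y" for y
    using that by (simp add: U_def base_in_hull_under)
  have UM: "u \<in> M" if "u \<in> U" for u
    using that by (simp add: M_def base_in_hull_under)
  have eU: "e u \<in> U" if "u \<in> U" for u
    using that unfolding U_def by (rule hull_under_step[OF lin_e])
  have hM: "h x \<in> M" if "x \<in> M" for x
    using that unfolding M_def by (rule hull_under_step[OF lin_h])
  have pU: "p u = smul \<mu> u" if "u \<in> U" for u
  proof -
    have "U \<subseteq> {x. p x = smul \<mu> x}"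
      unfolding U_def
      by (rule hull_under_least) (auto simp: subspace_def P.zero P.add P.scale scale_right_distrib
          pY pe E.scale scale_left_commute)
    then show ?thesis using that by auto
  qed
  have qU: "q u \<in> U" if "u \<in> U" for u
  proof -
    have "U \<subseteq> {x\<in>U. q x \<in> U}"
      unfolding U_def
    proof (rule hull_under_least, fold U_def)
      show "subspace {x \<in> U. q x \<in> U}"
        using subU by (auto simp: subspace_def Q.zero Q.add Q.scale)
    qed (auto simp: qY qe pU YU eU intro!: subspace_scale[OF subU] subspace_diff[OF subU])
    then show ?thesis using that by auto
  qed
  have eM: "e x \<in> M" if "x \<in> M" for x
    using lin_e lin_h _ _ that[unfolded M_def] unfolding M_def
  proof (rule shifted_maps_hull[where s = "-2"])
    show "e (h x) = h (e x) + smul (- 2) (e x)" for x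
      using scale_left_distrib[of "1" "1" "e x"] by (simp add: eh)
  qed (use eU UM in \<open>auto simp: M_def\<close>)
  have pM: "p x \<in> M" if "x \<in> M" for x
    using lin_p lin_h _ _ that[unfolded M_def] unfolding M_def
    by (rule shifted_maps_hull[where s = "-1"])
      (use UM pU subspace_scale[OF subU] in \<open>auto simp: ph M_def\<close>)
  have qM: "q x \<in> M" if "x \<in> M" for x
    using lin_q lin_h _ _ that[unfolded M_def] unfolding M_def
    by (rule shifted_maps_hull[where s = "1"]) (use qU UM in \<open>auto simp: qh M_def\<close>)
  have fY: "f y \<in> M" if y: "y \<in> Y" for y
  proof -
    \<comment> \<open>Moving \<open>p p\<close> to the right of \<open>f\<close> makes \<open>f y\<close> appear with the invertible coefficient \<open>\<mu>\<^sup>2\<close>.\<close>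
    have "casimir y = smul (\<mu> * \<mu>) (f y) - (q (p y) + q (p y)) - q (q (e y)) - h (p (q y))"
      using pY[OF y] qY[OF y] by (simp add: casimir_def op_simps P.scale F.scale Q.scale mult.commute
          scale_right_diff_distrib)
    then have "smul (\<mu> * \<mu>) (f y) = casimir y + (q (p y) + q (p y)) + q (q (e y)) + h (p (q y))"
      by simp
    moreover have "\<dots> \<in> M"
      using UM[OF YU[OF y]] CY[OF y, THEN YU, THEN UM]
      by (intro subspace_add[OF subM]) (auto intro: hM eM pM qM)
    ultimately have "smul (inverse (\<mu> * \<mu>)) (smul (\<mu> * \<mu>) (f y)) \<in> M"
      using subspace_scale[OF subM] by metis
    moreover have "inverse (\<mu> * \<mu>) * (\<mu> * \<mu>) = 1"
      using \<mu> by (simp add: field_simps)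
    ultimately show ?thesis by (simp only: scale_scale scale_one)
  qed
  have fU: "f u \<in> M" if "u \<in> U" for u
  proof -
    have "U \<subseteq> {x\<in>U. f x \<in> M}"
      unfolding U_def
    proof (rule hull_under_least, fold U_def)
      show "subspace {x \<in> U. f x \<in> M}"
        using subU subM by (auto simp: subspace_def F.zero F.add F.scale)
    qed (auto simp: fe intro: subspace_diff[OF subM] fY YU eU eM hM UM)
    then show ?thesis using that by auto
  qed
  have fM: "f x \<in> M" if "x \<in> M" for x
    using lin_f lin_h _ _ that[unfolded M_def] unfolding M_def
  proof (rule shifted_maps_hull[where s = "2"])
    show "f (h x) = h (f x) + smul 2 (f x)" for x
      using scale_left_distrib[of "1" "1" "f x"] by (simp add: fh)
  qed (use fU in \<open>auto simp: M_def\<close>)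
  have "stable M"
    using subM eM hM fM pM qM by (simp add: stable_def)
  then have "M = UNIV"
    using gen YU UM by blast
  have nz: "of_nat (Suc n) * \<mu> \<noteq> 0" for n
    using \<mu> by (simp del: of_nat_Suc)
  have lin_shift: "Vector_Spaces.linear smul smul (\<lambda>x. X x - smul c x)"
    if "Vector_Spaces.linear smul smul X" for X c
  proof -
    interpret X: Vector_Spaces.linear smul smul X by fact
    show ?thesis by unfold_locales (simp_all add: X.add X.scale algebra_simps)
  qed
  have N: "subspace N" "\<And>x. x \<in> N \<Longrightarrow> e x \<in> N" "\<And>x. x \<in> N \<Longrightarrow> h x \<in> N"
    "\<And>x. x \<in> N \<Longrightarrow> p x \<in> N" "\<And>x. x \<in> N \<Longrightarrow> q x \<in> N"
    using N by (auto simp: stable_def)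
  have step1: "v \<in> hull_under h (N \<inter> U)" if v: "v \<in> N" for v
  proof (rule lowering_coefficients[OF lin_h lin_shift[OF lin_p, of \<mu>] _ subU _ _ _ nz N(1,3) _ v,
        where H = UNIV and s = 1])
    show "p (h x) - smul \<mu> (h x) = h (p x - smul \<mu> x) - smul 1 (p x - smul \<mu> x) - smul \<mu> x" for x
      by (simp add: ph H.diff H.scale)
    show "v \<in> hull_under h U"
      using \<open>M = UNIV\<close> by (simp add: M_def)
    show "p x - smul \<mu> x \<in> N" if "x \<in> N" for x
      using subspace_diff[OF N(1) N(4)[OF that] subspace_scale[OF N(1) that]] .
  qed (use pU in auto)
  have step2: "v \<in> hull_under e (N \<inter> Y)" if v: "v \<in> N" "v \<in> U" for v
  proof (rule lowering_coefficients[OF lin_e lin_shift[OF lin_q, of \<nu>] _ Y _ _ _ nz N(1,2) _ v(1),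
        where H = U and s = 0])
    show "q (e x) - smul \<nu> (e x) = e (q x - smul \<nu> x) - smul 0 (q x - smul \<nu> x) - smul \<mu> x"
      if "x \<in> U" for x
      using pU[OF that] by (simp add: qe E.diff E.scale)
    show "v \<in> hull_under e Y"
      using v by (simp add: U_def)
    show "q x - smul \<nu> x \<in> N" if "x \<in> N" for x
      using subspace_diff[OF N(1) N(5)[OF that] subspace_scale[OF N(1) that]] .
  qed (use qY YU eU in auto)
  have L': "subspace L" "\<And>x. x \<in> L \<Longrightarrow> e x \<in> L" "\<And>x. x \<in> L \<Longrightarrow> h x \<in> L"
    using L by (auto simp: stable_def)
  have "hull_under e (N \<inter> Y) \<subseteq> L"
    by (rule hull_under_least) (use L' NL in auto)
  then have "N \<inter> U \<subseteq> L"
    using step2 by blast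
  then have "hull_under h (N \<inter> U) \<subseteq> L"
    by (intro hull_under_least) (use L' in auto)
  then show ?thesis
    using step1 by blast
qed

text \<open>The automorphism that exchanges \<open>e\<close> with \<open>f\<close> and \<open>p\<close> with \<open>q\<close> and negates \<open>h\<close> and \<open>z\<close>.
  It negates the Casimir operator and reduces the case in which \<open>p\<close> acts on \<open>Y\<close> by zero to the one already treated.\<close>

lemma opposite: "schrodinger_operators smul f (\<lambda>x. - h x) e q p"
  by unfold_locales (simp_all add: op_simps lin_e lin_f lin_p lin_q F.scale E.scale P.scale Q.scale H.scale)

lemma stable_le_by_eigenvectors:
  assumes "\<mu> \<noteq> 0 \<or> \<nu> \<noteq> 0" and Y: "subspace Y"
    and pY: "\<And>y. y \<in> Y \<Longrightarrow> p y = smul \<mu> y" and qY: "\<And>y. y \<in> Y \<Longrightarrow> q y = smul \<nu> y"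
    and CY: "\<And>y. y \<in> Y \<Longrightarrow> casimir y \<in> Y"
    and gen: "\<And>M. stable M \<Longrightarrow> Y \<subseteq> M \<Longrightarrow> M = UNIV"
    and N: "stable N" and L: "stable L" and NL: "N \<inter> Y \<subseteq> L"
  shows "N \<subseteq> L"
proof (cases "\<mu> = 0")
  case False
  then show ?thesis by (rule stable_le_by_eigenvectors_p) (fact Y pY qY CY gen N L NL)+
next
  case True
  interpret O: schrodinger_operators smul f "\<lambda>x. - h x" e q p by (rule opposite)
  have "- x \<in> M \<longleftrightarrow> x \<in> M" if "subspace M" for x M
    using subspace_neg[OF that, of x] subspace_neg[OF that, of "- x"] by auto
  then have st: "O.stable M \<longleftrightarrow> stable M" for M
    unfolding O.stable_def stable_def by blast
  have "O.casimir y = - casimir y" for y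
    by (simp add: O.casimir_def casimir_def qp)
  then have CY': "O.casimir y \<in> Y" if "y \<in> Y" for y
    using that CY subspace_neg[OF Y] by simp
  show ?thesis
    by (rule O.stable_le_by_eigenvectors_p[OF _ Y qY pY CY']) (use assms True st in auto)
qed

end

section \<open>The subalgebra generated by the Casimir element\<close>

lemma uea_const_0 [simp]: "uea_const 0 = 0"
  by transfer (simp add: uea_ideal_zero)

lemma uea_const_add: "uea_const (a + b) = uea_const a + uea_const b"
  by transfer (simp add: single_add uea_ideal_zero)

lemma uea_const_mult: "uea_const (a * b) = uea_const a * uea_const b"
  by transfer (simp add: mult_single uea_ideal_zero)

lemma uea_const_central: "uea_const c * a = a * uea_const c"
proof transfer
  fix c and a :: tensor_alg
  have "a = (\<Sum>u\<in>Poly_Mapping.keys a. Poly_Mapping.single u (Poly_Mapping.lookup a u))"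
    by (rule poly_mapping_eqI) (simp add: lookup_sum lookup_single when_def in_keys_iff)
  moreover have "Poly_Mapping.single 0 c * sum (\<lambda>u. Poly_Mapping.single u (l u)) S
      = sum (\<lambda>u. Poly_Mapping.single u (l u)) S * Poly_Mapping.single 0 c"
    for S and l :: "gword \<Rightarrow> complex"
    by (simp add: sum_distrib_left sum_distrib_right mult_single mult.commute)
  ultimately have "Poly_Mapping.single 0 c * a = a * Poly_Mapping.single 0 c"
    by metis
  then show "Poly_Mapping.single 0 c * a - a * Poly_Mapping.single 0 c \<in> uea_ideal"
    by (simp add: uea_ideal_zero)
qed

lemma poly_C0_upto:
  assumes "degree g \<le> n"
  shows "poly_C0 g = (\<Sum>i\<le>n. uea_const (coeff g i) * C0 ^ i)"
  unfolding poly_C0_def using assms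
  by (intro sum.mono_neutral_left) (auto simp: coeff_eq_0)

lemma poly_C0_0 [simp]: "poly_C0 0 = 0"
  by (simp add: poly_C0_def)

lemma poly_C0_pCons: "poly_C0 (pCons c g) = uea_const c + C0 * poly_C0 g"
proof -
  have "C0 * (\<Sum>i\<le>degree g. uea_const (coeff g i) * C0 ^ i)
      = (\<Sum>i\<le>degree g. uea_const (coeff g i) * C0 ^ Suc i)"
    by (simp add: sum_distrib_left mult.assoc[symmetric] flip: uea_const_central)
  moreover have "degree (pCons c g) \<le> Suc (degree g)"
    by (rule degree_pCons_le)
  ultimately show ?thesis
    by (subst poly_C0_upto[of _ "Suc (degree g)"])
      (simp_all only: sum.atMost_Suc_shift poly_C0_def coeff_pCons_0 coeff_pCons_Suc power_0 mult_1_right)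
qed

lemma poly_C0_const [simp]: "poly_C0 [:c:] = uea_const c"
  by (simp add: poly_C0_pCons)

lemma poly_C0_X: "poly_C0 [:0, 1:] = C0"
proof -
  have "uea_const 1 = 1"
    by transfer (simp add: uea_ideal_zero)
  then show ?thesis
    by (simp add: poly_C0_pCons)
qed

lemma poly_C0_add: "poly_C0 (f + g) = poly_C0 f + poly_C0 g"
  by (induction f g rule: poly_induct2)
    (simp_all add: poly_C0_pCons uea_const_add algebra_simps)

lemma poly_C0_smult: "poly_C0 (smult c g) = uea_const c * poly_C0 g"
  by (induction g)
    (simp_all add: poly_C0_pCons uea_const_mult distrib_left,
     metis mult.assoc uea_const_central)

lemma poly_C0_mult: "poly_C0 (f * g) = poly_C0 f * poly_C0 g"
  by (induction f)
    (simp_all add: poly_C0_pCons poly_C0_add poly_C0_smult distrib_right mult.assoc)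

lemma poly_C0_diff: "poly_C0 (f - g) = poly_C0 f - poly_C0 g"
  using poly_C0_add[of "f - g" g] by simp

lemma poly_C0_linear_factor: "poly_C0 [:- c, 1:] = C0 - uea_const c"
  using poly_C0_add[of "[:0, 1:]" "[:- c:]"] uea_const_add[of c "- c"]
  by (simp add: poly_C0_X eq_neg_iff_add_eq_0 add.commute flip: diff_conv_add_uminus)

lemma alg_C0_eq_range: "alg_C0 = range poly_C0"
proof
  have "subalgebra (range poly_C0)"
    unfolding subalgebra_def
    by (auto simp flip: poly_C0_const poly_C0_add poly_C0_mult)
  moreover have "C0 \<in> range poly_C0"
    using poly_C0_X by (metis rangeI)
  ultimately show "alg_C0 \<subseteq> range poly_C0"
    unfolding alg_C0_def by blast
next
  have "poly_C0 g \<in> A" if "subalgebra A" "C0 \<in> A" for g A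
  proof (induction g)
    case 0
    have "uea_const 0 \<in> A" using that(1) by (simp only: subalgebra_def)
    then show ?case by simp
  next
    case (pCons c g)
    then show ?case using that by (simp add: poly_C0_pCons subalgebra_def)
  qed
  then show "range poly_C0 \<subseteq> alg_C0"
    unfolding alg_C0_def by auto
qed

text \<open>The differential operators \<open>x \<partial>\<^sub>y\<close>, \<open>x \<partial>\<^sub>x - y \<partial>\<^sub>y\<close>, \<open>y \<partial>\<^sub>x + \<xi> x\<^bsup>-2\<^esup>\<close>, \<open>x\<close> and \<open>y\<close> on
  doubly infinite formal series in \<open>x\<close> and \<open>y\<close>, written in terms of the coefficients of \<open>x\<^sup>m y\<^sup>n\<close>.
  Without the summand \<open>\<xi> x\<^bsup>-2\<^esup>\<close> the Casimir element acts by zero; this summand makes it act by the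
  scalar \<open>\<xi>\<close>.\<close>

lemma laurent_operators:
  "schrodinger_operators (\<lambda>c (v :: int \<Rightarrow> int \<Rightarrow> complex) m n. c * v m n)
     (\<lambda>v m n. of_int (n + 1) * v (m - 1) (n + 1))
     (\<lambda>v m n. of_int (m - n) * v m n)
     (\<lambda>v m n. of_int (m + 1) * v (m + 1) (n - 1) + \<xi> * v (m + 2) n)
     (\<lambda>v m n. v (m - 1) n)
     (\<lambda>v m n. v m (n - 1))"
  by unfold_locales (auto simp: fun_eq_iff algebra_simps)

text \<open>The Casimir element is transcendental: for every \<open>\<xi>\<close> there is a nonzero module on which it
  acts by \<open>\<xi>\<close>, so a polynomial relation would have every complex number as a root. This replaces
  an appeal to the Poincare-Birkhoff-Witt theorem.\<close>

lemma poly_C0_eq_0_iff: "poly_C0 g = 0 \<longleftrightarrow> g = 0"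
proof
  assume g: "poly_C0 g = 0"
  have "poly g \<xi> = 0" for \<xi>
  proof -
    let ?smul = "\<lambda>c (v :: int \<Rightarrow> int \<Rightarrow> complex) m n. c * v m n"
    interpret L: schrodinger_operators ?smul
      "\<lambda>v m n. of_int (n + 1) * v (m - 1) (n + 1)"
      "\<lambda>v m n. of_int (m - n) * v m n"
      "\<lambda>v m n. of_int (m + 1) * v (m + 1) (n - 1) + \<xi> * v (m + 2) n"
      "\<lambda>v m n. v (m - 1) n"
      "\<lambda>v m n. v m (n - 1)"
      by (rule laurent_operators)
    interpret M: schrodinger_mod ?smul L.combined_action
      by (rule L.combined_action_module)
    let ?act = "uea_act ?smul L.combined_action"
    have C: "?act C0 v = ?smul \<xi> v" for v
      by (simp only: L.uea_act_C0 L.casimir_def) (auto simp: fun_eq_iff algebra_simps)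
    have "?act (poly_C0 g) v = ?smul (poly g \<xi>) v" for v
    proof (induction g)
      case 0
      show ?case using M.uea_act_const[of 0 v] by (simp only: poly_C0_0 uea_const_0 poly_0)
    next
      case (pCons c g)
      have "?act (poly_C0 (pCons c g)) v = ?smul c v + ?smul \<xi> (?smul (poly g \<xi>) v)"
        by (simp only: poly_C0_pCons M.uea_act_add M.uea_act_mult M.uea_act_const C pCons.IH)
      then show ?case
        by (simp only: fun_eq_iff poly_pCons plus_fun_apply distrib_right mult.assoc) simp
    qed
    from this[of "\<lambda>_ _. 1"] M.uea_act_const[of 0 "\<lambda>_ _. 1"]
    have "(\<lambda>(_::int) (_::int). 0 * (1::complex)) = (\<lambda>_ _. poly g \<xi> * 1)"
      by (simp only: g uea_const_0)
    then show ?thesis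
      by (metis mult_1_right mult_zero_left)
  qed
  then show "g = 0"
    using poly_all_0_iff_0 by blast
qed simp

section \<open>Ideals of complex polynomials\<close>

lemma poly_ideal_principal:
  fixes I :: "complex poly set"
  assumes "0 \<in> I" and add: "\<And>f g. f \<in> I \<Longrightarrow> g \<in> I \<Longrightarrow> f + g \<in> I"
    and mult: "\<And>r f. f \<in> I \<Longrightarrow> r * f \<in> I"
  obtains g where "g \<in> I" "\<And>f. f \<in> I \<Longrightarrow> g dvd f"
proof (cases "I = {0}")
  case True
  then show ?thesis using that[of 0] by auto
next
  case False
  then obtain g0 where "g0 \<in> I \<and> g0 \<noteq> 0" using assms(1) by blast
  then obtain g where g: "g \<in> I" "g \<noteq> 0" and min: "\<And>f. f \<in> I \<Longrightarrow> f \<noteq> 0 \<Longrightarrow> degree g \<le> degree f"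
    using ex_has_least_nat[of "\<lambda>g. g \<in> I \<and> g \<noteq> 0" g0 degree] by blast
  have "g dvd f" if "f \<in> I" for f
  proof (rule ccontr)
    assume "\<not> g dvd f"
    then have "f mod g \<noteq> 0" by (simp add: dvd_eq_mod_eq_0)
    moreover have "f mod g = f + (- (f div g)) * g"
      by (simp add: minus_div_mult_eq_mod[symmetric])
    then have "f mod g \<in> I" using add mult \<open>f \<in> I\<close> g(1) by metis
    ultimately show False
      using min[of "f mod g"] degree_mod_less[OF g(2), of f] by auto
  qed
  then show ?thesis using that g(1) by blast
qed

lemma complex_poly_nonunit_root:
  fixes g :: "complex poly"
  assumes "\<not> is_unit g"
  obtains x where "poly g x = 0"
proof (cases "g = 0")
  case True
  then show ?thesis using that by simp
next
  case False
  then have "degree g \<noteq> 0" using assms by (simp add: is_unit_iff_degree)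
  then show ?thesis
    using fundamental_theorem_of_algebra[of g] that by (auto simp: constant_degree)
qed

lemma poly_bezout:
  fixes c :: "'i \<Rightarrow> complex poly"
  assumes fin: "finite I" and roots: "\<And>x. \<exists>i\<in>I. poly (c i) x \<noteq> 0"
  obtains u where "(\<Sum>i\<in>I. u i * c i) = 1"
proof -
  let ?J = "range (\<lambda>u. \<Sum>i\<in>I. u i * c i)"
  have "0 \<in> ?J" by (rule image_eqI[of _ _ "\<lambda>_. 0"]) simp_all
  moreover have "f + g \<in> ?J" if "f \<in> ?J" "g \<in> ?J" for f g
  proof -
    from that obtain u v where "f = (\<Sum>i\<in>I. u i * c i)" "g = (\<Sum>i\<in>I. v i * c i)" by blast
    then show ?thesis
      by (intro image_eqI[where x = "\<lambda>i. u i + v i"]) (simp_all add: distrib_right sum.distrib)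
  qed
  moreover have mult: "r * f \<in> ?J" if "f \<in> ?J" for r f
  proof -
    from that obtain u where "f = (\<Sum>i\<in>I. u i * c i)" by blast
    then show ?thesis
      by (intro image_eqI[where x = "\<lambda>i. r * u i"]) (simp_all add: sum_distrib_left mult.assoc)
  qed
  ultimately obtain g where g: "g \<in> ?J" and dvd: "\<And>f. f \<in> ?J \<Longrightarrow> g dvd f"
    by (rule poly_ideal_principal[of ?J]) blast+
  have "is_unit g"
  proof (rule ccontr)
    assume "\<not> is_unit g"
    then obtain x where x: "poly g x = 0" by (rule complex_poly_nonunit_root)
    have "c i \<in> ?J" if "i \<in> I" for i
      by (rule image_eqI[of _ _ "\<lambda>j. if j = i then 1 else 0"])
        (use that fin in \<open>simp_all add: if_distrib[of "\<lambda>u. u * _"] cong: if_cong\<close>)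
    then have "poly (c i) x = 0" if "i \<in> I" for i
      using dvd that x by (fastforce elim: dvdE)
    then show False using roots by blast
  qed
  then obtain r where "1 = g * r" by (rule dvdE)
  then have "1 \<in> ?J" using mult[OF g, of r] by (simp add: mult.commute)
  then show ?thesis using that by (metis (no_types, lifting) imageE)
qed

section \<open>Submodules of an annihilated quasi-Whittaker module\<close>

context schrodinger_mod
begin

lemma uea_act_linear: "Vector_Spaces.linear smul smul (uea_act smul \<rho> a)"
  unfolding uea_act_def[abs_def] by (rule T_linear)

sublocale A: Vector_Spaces.linear smul smul "uea_act smul \<rho> a" for a
  by (rule uea_act_linear)

sublocale L: Vector_Spaces.linear "(*s)" smul "\<lambda>s. \<rho> s v" for v
  by (rule lin_left)

lemma uea_act_0_left: "uea_act smul \<rho> 0 v = 0"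
  using uea_act_add[of 0 0 v] by simp

lemma uea_act_diff: "uea_act smul \<rho> (a - b) v = uea_act smul \<rho> a v - uea_act smul \<rho> b v"
  using uea_act_add[of "a - b" b v] by simp

lemma act_expand: "\<rho> s v = (\<Sum>i\<in>UNIV. smul (s $ i) (\<rho> (basis_vec i) v))"
proof -
  have "\<rho> (\<Sum>i\<in>UNIV. s $ i *s basis_vec i) v = (\<Sum>i\<in>UNIV. smul (s $ i) (\<rho> (basis_vec i) v))"
    by (simp only: L.sum L.scale)
  then show ?thesis by (simp only: basis_expansion)
qed

lemma submodule_subspace: "submodule smul \<rho> N \<Longrightarrow> V.subspace N"
  by (simp add: submodule_def V.subspace_def)

lemma submoduleI:
  assumes "V.subspace N" "\<And>s x. x \<in> N \<Longrightarrow> \<rho> s x \<in> N"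
  shows "submodule smul \<rho> N"
  using assms by (simp add: submodule_def V.subspace_def)

lemma submodule_uea_act:
  assumes N: "submodule smul \<rho> N" and v: "v \<in> N"
  shows "uea_act smul \<rho> a v \<in> N"
proof -
  have "word_act \<rho> u v \<in> N" for u
  proof -
    have "foldr (\<lambda>i. \<rho> (basis_vec i)) xs v \<in> N" for xs
      using N v by (induction xs) (auto simp: submodule_def)
    then show ?thesis by (simp add: word_act_def)
  qed
  then show ?thesis
    unfolding uea_act_def tensor_act_def
    using submodule_subspace[OF N] by (intro V.subspace_sum V.subspace_scale)
qed

end

locale quasi_whittaker_annihilated = schrodinger_mod smul \<rho>
  for smul :: "complex \<Rightarrow> 'v \<Rightarrow> 'v::ab_group_add" and \<rho> :: "schrodinger \<Rightarrow> 'v \<Rightarrow> 'v" +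
  fixes \<phi> :: "schrodinger \<Rightarrow> complex" and w :: 'v and d :: "complex poly"
  assumes hom: "heisenberg_hom \<phi>" and \<phi>_nonzero: "\<exists>x\<in>heisenberg. \<phi> x \<noteq> 0"
    and cyclic: "quasi_whittaker_module smul \<rho> \<phi> UNIV w"
    and generator: "monic_generator d (ann_C0 smul \<rho> w)"
begin

abbreviation "op_e \<equiv> \<rho> (basis_vec GE)"
abbreviation "op_h \<equiv> \<rho> (basis_vec GH)"
abbreviation "op_f \<equiv> \<rho> (basis_vec GF)"
abbreviation "op_p \<equiv> \<rho> (basis_vec GP)"
abbreviation "op_q \<equiv> \<rho> (basis_vec GQ)"

lemma basis_in_heisenberg:
  "basis_vec GP \<in> heisenberg" "basis_vec GQ \<in> heisenberg" "basis_vec GZ \<in> heisenberg"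
  unfolding heisenberg_def by (rule vec.span_base; simp)+

lemma heisenberg_w: "x \<in> heisenberg \<Longrightarrow> \<rho> x w = smul (\<phi> x) w"
  using cyclic by (simp add: quasi_whittaker_module_def quasi_whittaker_vector_def)

lemma cyclic_vector: "\<exists>a. v = uea_act smul \<rho> a w"
  using cyclic unfolding quasi_whittaker_module_def cyclic_submodule_def by blast

lemma submodule_containing_w: "submodule smul \<rho> N \<Longrightarrow> w \<in> N \<Longrightarrow> N = UNIV"
  using submodule_uea_act cyclic_vector by (metis UNIV_eq_I)

lemma \<phi>_Z: "\<phi> (basis_vec GZ) = 0"
proof -
  have "lie_bracket (basis_vec GP) (basis_vec GQ) = basis_vec GZ"
    by (simp add: lie_bracket_basis)
  then show ?thesis
    using hom basis_in_heisenberg unfolding heisenberg_hom_def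
    by (metis cancel_comm_monoid_add_class.diff_cancel mult.commute)
qed

lemma \<phi>_P_or_Q: "\<phi> (basis_vec GP) \<noteq> 0 \<or> \<phi> (basis_vec GQ) \<noteq> 0"
proof (rule ccontr)
  assume neg: "\<not> ?thesis"
  have "heisenberg \<subseteq> {x \<in> heisenberg. \<phi> x = 0}"
    unfolding heisenberg_def
  proof (rule vec.span_minimal, fold heisenberg_def)
    have "\<phi> (0 *s basis_vec GP) = 0 * \<phi> (basis_vec GP)"
      using hom basis_in_heisenberg(1) unfolding heisenberg_hom_def by blast
    then show "vec.subspace {x \<in> heisenberg. \<phi> x = 0}"
      using hom vec.subspace_span[of "{basis_vec GP, basis_vec GQ, basis_vec GZ}"]
      by (auto simp: vec.subspace_def heisenberg_hom_def simp flip: heisenberg_def)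
  qed (use neg \<phi>_Z basis_in_heisenberg in auto)
  then show False using \<phi>_nonzero by auto
qed

text \<open>As \<open>z\<close> is a central commutator of \<open>p\<close> and \<open>q\<close>, it kills \<open>w\<close>, and its kernel is a submodule.\<close>

lemma z_acts_zero: "\<rho> (basis_vec GZ) v = 0"
proof -
  have central: "lie_bracket (basis_vec GZ) s = 0" for s
    by (simp add: vec_eq_iff lie_bracket_component axis_def split: gen.split)
  have "submodule smul \<rho> {v. \<rho> (basis_vec GZ) v = 0}"
  proof (rule submoduleI)
    show "V.subspace {v. \<rho> (basis_vec GZ) v = 0}"
      by (simp add: V.subspace_def R.add R.scale R.zero)
    show "\<rho> s x \<in> {v. \<rho> (basis_vec GZ) v = 0}" if "x \<in> {v. \<rho> (basis_vec GZ) v = 0}" for s x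
      using act_bracket[of "basis_vec GZ" s x] that by (simp add: central L.zero R.zero)
  qed
  moreover have "\<rho> (basis_vec GZ) w = 0"
    using heisenberg_w[OF basis_in_heisenberg(3)] by (simp add: \<phi>_Z)
  ultimately show ?thesis
    using submodule_containing_w by blast
qed

lemma act_swap:
  "\<rho> (basis_vec i) (\<rho> (basis_vec j) v)
     = \<rho> (basis_vec j) (\<rho> (basis_vec i) v) + \<rho> (base_bracket i j - base_bracket j i) v"
  using act_bracket[of "basis_vec i" "basis_vec j" v] by (simp add: lie_bracket_basis)

sublocale O: schrodinger_operators smul op_e op_h op_f op_p op_q
proof -
  have two: "smul 2 y = y + y" for y
    using V.scale_left_distrib[of 1 1 y] by simp
  note swap = act_swap[of GE GH] act_swap[of GF GH] act_swap[of GP GH] act_swap[of GQ GH]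
    act_swap[of GF GE] act_swap[of GP GE] act_swap[of GQ GE] act_swap[of GP GF] act_swap[of GQ GF]
    act_swap[of GQ GP]
  show "schrodinger_operators smul op_e op_h op_f op_p op_q"
    by unfold_locales (simp_all add: swap L.diff L.neg L.scale L.zero two z_acts_zero
        R.add R.scale)
qed

lemma submodule_iff_stable: "submodule smul \<rho> N \<longleftrightarrow> O.stable N"
proof
  assume N: "O.stable N"
  then have sub: "V.subspace N" by (simp add: O.stable_def)
  have "\<rho> (basis_vec i) x \<in> N" if "x \<in> N" for i x
    using N that V.subspace_0[OF sub] by (cases i) (simp_all add: O.stable_def z_acts_zero)
  then show "submodule smul \<rho> N"
    by (intro submoduleI sub, subst act_expand)
      (intro V.subspace_sum[OF sub] V.subspace_scale[OF sub])
qed (simp add: O.stable_def submodule_subspace, simp add: submodule_def)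

lemma uea_act_C0: "uea_act smul \<rho> C0 v = O.casimir v"
  by (simp add: C0_def power2_eq_square uea_act_diff uea_act_mult uea_act_uea_of O.casimir_def)

text \<open>In the enveloping algebra the Casimir element commutes with the generators only modulo \<open>z\<close>;
  as \<open>z\<close> acts by zero here, its polynomials act by module endomorphisms.\<close>

definition central_act :: "complex poly \<Rightarrow> 'v \<Rightarrow> 'v" where
  "central_act g v = uea_act smul \<rho> (poly_C0 g) v"

lemma central_act_linear: "Vector_Spaces.linear smul smul (central_act g)"
  unfolding central_act_def[abs_def] by (rule uea_act_linear)

sublocale central_act: Vector_Spaces.linear smul smul "central_act g" for g
  by (rule central_act_linear)

lemma central_act_0: "central_act 0 v = 0"
  by (simp add: central_act_def uea_act_0_left)

lemma central_act_const: "central_act [:c:] v = smul c v"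
  by (simp add: central_act_def uea_act_const)

lemma central_act_1: "central_act 1 v = v"
  using central_act_const[of 1 v] by (simp add: one_pCons)

lemma central_act_add: "central_act (f + g) v = central_act f v + central_act g v"
  by (simp add: central_act_def poly_C0_add uea_act_add)

lemma central_act_mult: "central_act (f * g) v = central_act f (central_act g v)"
  by (simp add: central_act_def poly_C0_mult uea_act_mult)

lemma central_act_mult_swap: "central_act (f * g) v = central_act g (central_act f v)"
  using central_act_mult[of g f v] by (simp add: mult.commute)

lemma central_act_sum: "central_act (sum f S) v = (\<Sum>i\<in>S. central_act (f i) v)"
  by (induction S rule: infinite_finite_induct) (simp_all add: central_act_0 central_act_add)

lemma central_act_linear_factor: "central_act [:- c, 1:] v = uea_act smul \<rho> (C0 - uea_const c) v"
  by (simp add: central_act_def poly_C0_linear_factor)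

lemma casimir_act: "O.casimir (\<rho> s v) = \<rho> s (O.casimir v)"
proof -
  interpret C: Vector_Spaces.linear smul smul O.casimir
    unfolding uea_act_C0[symmetric] by (rule uea_act_linear)
  have "O.casimir (\<rho> (basis_vec i) v) = \<rho> (basis_vec i) (O.casimir v)" for i
    by (cases i) (simp_all add: O.casimir_commute z_acts_zero C.zero)
  then show ?thesis
    by (simp add: act_expand[of s] C.sum C.scale)
qed

lemma central_act_act: "central_act g (\<rho> s v) = \<rho> s (central_act g v)"
proof (induction g)
  case 0
  then show ?case by (simp add: central_act_0 R.zero)
next
  case (pCons c g)
  have step: "central_act (pCons c g) u = smul c u + O.casimir (central_act g u)" for u
    by (simp add: central_act_def poly_C0_pCons uea_act_add uea_act_mult uea_act_const uea_act_C0)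
  show ?case
    by (simp add: step pCons.IH casimir_act R.add R.scale)
qed

lemma central_act_uea_act: "central_act g (uea_act smul \<rho> a v) = uea_act smul \<rho> a (central_act g v)"
proof -
  have "central_act g (word_act \<rho> u v) = word_act \<rho> u (central_act g v)" for u
  proof -
    have "central_act g (foldr (\<lambda>i. \<rho> (basis_vec i)) xs v)
        = foldr (\<lambda>i. \<rho> (basis_vec i)) xs (central_act g v)" for xs
      by (induction xs) (simp_all add: central_act_act)
    then show ?thesis by (simp add: word_act_def)
  qed
  then show ?thesis
    by (simp add: uea_act_def tensor_act_def central_act.sum central_act.scale)
qed

lemma submodule_range: "submodule smul \<rho> (range (central_act g))"
proof (rule submoduleI)
  show "V.subspace (range (central_act g))"
    by (rule central_act.subspace_image) simp
qed (auto simp flip: central_act_act)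

lemma submodule_central_act: "submodule smul \<rho> N \<Longrightarrow> v \<in> N \<Longrightarrow> central_act g v \<in> N"
  unfolding central_act_def by (rule submodule_uea_act)

lemma cyclic_submodule_central_act: "cyclic_submodule smul \<rho> (central_act g w) = range (central_act g)"
proof -
  have "central_act g v \<in> cyclic_submodule smul \<rho> (central_act g w)" for v
    using cyclic_vector[of v] by (auto simp: cyclic_submodule_def central_act_uea_act)
  then show ?thesis
    by (auto simp: cyclic_submodule_def simp flip: central_act_uea_act)
qed

lemma range_central_act_mono: "f dvd g \<Longrightarrow> range (central_act g) \<subseteq> range (central_act f)"
  by (auto elim!: dvdE simp: central_act_mult)

lemma d_nonzero: "d \<noteq> 0"
  using generator by (auto simp: monic_generator_def)

text \<open>The generator of the annihilator is given inside the enveloping algebra. The transcendence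
  of the Casimir element is what turns this into a statement about divisibility of polynomials.\<close>

lemma central_act_w_eq_0_iff: "central_act g w = 0 \<longleftrightarrow> d dvd g"
proof -
  have "central_act g w = 0 \<longleftrightarrow> poly_C0 g \<in> ann_C0 smul \<rho> w"
    by (simp add: ann_C0_def alg_C0_eq_range central_act_def)
  also have "\<dots> \<longleftrightarrow> (\<exists>h. poly_C0 g = poly_C0 (d * h))"
    using generator by (auto simp: monic_generator_def alg_C0_eq_range poly_C0_mult)
  also have "\<dots> \<longleftrightarrow> (\<exists>h. g = d * h)"
    using poly_C0_eq_0_iff[of "g - d * _"] by (metis eq_iff_diff_eq_0 poly_C0_diff)
  finally show ?thesis by (simp add: dvd_def)
qed

text \<open>The vectors \<open>g(C\<^sub>0) w\<close> form a space of simultaneous eigenvectors of \<open>p\<close> and \<open>q\<close>, not both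
  with eigenvalue zero, that is stable under the Casimir element.\<close>

lemma submodule_le:
  assumes N: "submodule smul \<rho> N" and L: "submodule smul \<rho> L"
    and le: "\<And>g. central_act g w \<in> N \<Longrightarrow> central_act g w \<in> L"
  shows "N \<subseteq> L"
proof (rule O.stable_le_by_eigenvectors[OF \<phi>_P_or_Q, of "range (\<lambda>g. central_act g w)"])
  show "V.subspace (range (\<lambda>g. central_act g w))"
    unfolding V.subspace_def
  proof (intro conjI allI ballI)
    show "0 \<in> range (\<lambda>g. central_act g w)"
      by (rule range_eqI[of _ _ 0]) (simp add: central_act_0)
  next
    fix x y assume "x \<in> range (\<lambda>g. central_act g w)" "y \<in> range (\<lambda>g. central_act g w)"
    then obtain g h where "x = central_act g w" "y = central_act h w" by blast
    then show "x + y \<in> range (\<lambda>g. central_act g w)"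
      by (intro range_eqI[of _ _ "g + h"]) (simp add: central_act_add)
  next
    fix c x assume "x \<in> range (\<lambda>g. central_act g w)"
    then obtain g where "x = central_act g w" by blast
    then show "smul c x \<in> range (\<lambda>g. central_act g w)"
      by (intro range_eqI[of _ _ "[:c:] * g"]) (simp only: central_act_mult central_act_const)
  qed
  show "op_p y = smul (\<phi> (basis_vec GP)) y" if "y \<in> range (\<lambda>g. central_act g w)" for y
    using that heisenberg_w[OF basis_in_heisenberg(1)] central_act.scale by (auto simp flip: central_act_act)
  show "op_q y = smul (\<phi> (basis_vec GQ)) y" if "y \<in> range (\<lambda>g. central_act g w)" for y
    using that heisenberg_w[OF basis_in_heisenberg(2)] central_act.scale by (auto simp flip: central_act_act)
  show "O.casimir y \<in> range (\<lambda>g. central_act g w)" if "y \<in> range (\<lambda>g. central_act g w)" for y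
  proof -
    have C: "O.casimir v = central_act [:0, 1:] v" for v
      by (simp add: central_act_def poly_C0_X uea_act_C0)
    from that obtain g where "y = central_act g w" by blast
    then show ?thesis
      by (intro range_eqI[of _ _ "[:0, 1:] * g"]) (simp only: C central_act_mult)
  qed
  show "M = UNIV" if "O.stable M" "range (\<lambda>g. central_act g w) \<subseteq> M" for M
  proof (rule submodule_containing_w)
    have "central_act 1 w \<in> M" using that by blast
    then show "w \<in> M" by (simp only: central_act_1)
  qed (use that in \<open>simp add: submodule_iff_stable\<close>)
qed (use N L le in \<open>auto simp flip: submodule_iff_stable\<close>)

text \<open>The polynomials \<open>g\<close> with \<open>g(C\<^sub>0) w\<close> in \<open>N\<close> form an ideal that contains \<open>d\<close>, and a generator
  of this ideal generates \<open>N\<close>. With the next lemma the lattice of submodules becomes that of the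
  divisors of \<open>d\<close>, reversed.\<close>

lemma submodule_eq_range:
  assumes N: "submodule smul \<rho> N"
  obtains g where "g dvd d" "N = range (central_act g)"
proof -
  note sub = submodule_subspace[OF N]
  have "0 \<in> {g. central_act g w \<in> N}"
    using V.subspace_0[OF sub] by (simp add: central_act_0)
  then obtain g where g: "central_act g w \<in> N" and dvd: "\<And>f. central_act f w \<in> N \<Longrightarrow> g dvd f"
  proof (rule poly_ideal_principal)
    show "f + g \<in> {g. central_act g w \<in> N}"
      if "f \<in> {g. central_act g w \<in> N}" "g \<in> {g. central_act g w \<in> N}" for f g
      using that V.subspace_add[OF sub] by (simp add: central_act_add)
    show "r * f \<in> {g. central_act g w \<in> N}" if "f \<in> {g. central_act g w \<in> N}" for r f
      using that submodule_central_act[OF N] by (simp add: central_act_mult)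
  qed blast
  have "g dvd d"
    using dvd central_act_w_eq_0_iff[of d] V.subspace_0[OF sub] by simp
  moreover have "N = range (central_act g)"
  proof
    show "N \<subseteq> range (central_act g)"
      using range_central_act_mono[OF dvd] by (intro submodule_le[OF N submodule_range]) blast
    show "range (central_act g) \<subseteq> N"
      unfolding cyclic_submodule_central_act[symmetric] cyclic_submodule_def
      using submodule_uea_act[OF N g] by blast
  qed
  ultimately show ?thesis using that by blast
qed

text \<open>If \<open>g(C\<^sub>0) w = f(C\<^sub>0) v\<close> and \<open>d = f r\<close>, then \<open>r g\<close> kills \<open>w\<close>, hence \<open>f r\<close> divides \<open>r g\<close>.\<close>

lemma range_central_act_le_iff:
  assumes "f dvd d"
  shows "range (central_act g) \<subseteq> range (central_act f) \<longleftrightarrow> f dvd g"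
proof
  assume "range (central_act g) \<subseteq> range (central_act f)"
  then obtain v where v: "central_act g w = central_act f v" by blast
  obtain r where r: "d = f * r" using assms by (rule dvdE)
  obtain a where a: "v = uea_act smul \<rho> a w" using cyclic_vector by blast
  have "central_act (r * g) w = central_act r (central_act f v)" by (simp only: central_act_mult v)
  also have "\<dots> = central_act d v" by (simp only: r central_act_mult_swap)
  also have "\<dots> = 0"
    using central_act_w_eq_0_iff[of d] by (simp add: a central_act_uea_act A.zero)
  finally have "f * r dvd r * g" using central_act_w_eq_0_iff r by simp
  then have "r * f dvd r * g" by (simp only: mult.commute)
  then show "f dvd g" using d_nonzero r by auto
qed (rule range_central_act_mono)

lemma range_central_act_eq_0_iff: "range (central_act g) = {0} \<longleftrightarrow> d dvd g"
proof -
  have "central_act d w = 0"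
    by (simp add: central_act_w_eq_0_iff)
  then have "range (central_act d) = {0}"
    unfolding cyclic_submodule_central_act[symmetric] by (simp add: cyclic_submodule_def A.zero)
  then have "range (central_act g) \<subseteq> {0} \<longleftrightarrow> d dvd g"
    using range_central_act_le_iff[of d g] by (simp only: dvd_refl)
  then show ?thesis
    by (simp only: subset_singleton_iff) simp
qed

lemma range_central_act_eq_UNIV_iff:
  assumes "g dvd d"
  shows "range (central_act g) = UNIV \<longleftrightarrow> is_unit g"
proof -
  have G1: "range (central_act 1) = UNIV"
    unfolding central_act_1[abs_def] by (rule surj_id[unfolded id_def])
  have "range (central_act g) = UNIV \<longleftrightarrow> UNIV \<subseteq> range (central_act g)"
    by (rule top.extremum_unique[symmetric])
  also have "\<dots> \<longleftrightarrow> range (central_act 1) \<subseteq> range (central_act g)"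
    by (simp only: G1)
  also have "\<dots> \<longleftrightarrow> is_unit g"
    by (rule range_central_act_le_iff[OF assms])
  finally show ?thesis .
qed

end

section \<open>Simple quotients\<close>

context schrodinger_mod
begin

lemma add_coset_eq_iff:
  assumes N: "V.subspace N"
  shows "add_coset x N = add_coset y N \<longleftrightarrow> x - y \<in> N"
proof
  assume "add_coset x N = add_coset y N"
  moreover have "x \<in> add_coset x N"
    unfolding add_coset_def using V.subspace_0[OF N] by force
  ultimately show "x - y \<in> N"
    by (auto simp: add_coset_def)
next
  have sub: "add_coset x N \<subseteq> add_coset y N" if "x - y \<in> N" for x y
  proof
    fix v assume "v \<in> add_coset x N"
    then obtain n where "n \<in> N" "v = x + n" by (auto simp: add_coset_def)
    then have "v = y + ((x - y) + n)" "(x - y) + n \<in> N"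
      using V.subspace_add[OF N that] by auto
    then show "v \<in> add_coset y N" unfolding add_coset_def by blast
  qed
  assume "x - y \<in> N"
  moreover from V.subspace_neg[OF N this] have "y - x \<in> N" by simp
  ultimately show "add_coset x N = add_coset y N"
    using sub by blast
qed

lemma add_coset_mem_carrier_iff:
  assumes N: "V.subspace N" and L: "V.subspace L" and "N \<subseteq> L"
  shows "add_coset x N \<in> quotient_carrier L N \<longleftrightarrow> x \<in> L"
proof
  assume "add_coset x N \<in> quotient_carrier L N"
  then obtain y where "y \<in> L" "x - y \<in> N"
    by (auto simp: quotient_carrier_def add_coset_eq_iff[OF N])
  then show "x \<in> L"
    using V.subspace_add[OF L, of "x - y" y] \<open>N \<subseteq> L\<close> by auto
qed (auto simp: quotient_carrier_def)

lemma quotient_carrier_self: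
  assumes N: "V.subspace N"
  shows "quotient_carrier N N = {add_coset 0 N}"
proof -
  have "add_coset x N = add_coset 0 N" if "x \<in> N" for x
    using that by (simp add: add_coset_eq_iff[OF N])
  then show ?thesis
    unfolding quotient_carrier_def using V.subspace_0[OF N] by blast
qed

lemma quotient_carrier_eq_iff:
  assumes "V.subspace N" "V.subspace L" "N \<subseteq> L" "V.subspace L'" "N \<subseteq> L'"
  shows "quotient_carrier L N = quotient_carrier L' N \<longleftrightarrow> L = L'"
  using assms add_coset_mem_carrier_iff by blast

lemma quotient_submodule_carrier:
  assumes N: "submodule smul \<rho> N" and L: "submodule smul \<rho> L" and "N \<subseteq> L" "L \<subseteq> M"
  shows "quotient_submodule smul \<rho> M N (quotient_carrier L N)"
proof -
  note mem = add_coset_mem_carrier_iff[OF submodule_subspace[OF N] submodule_subspace[OF L] \<open>N \<subseteq> L\<close>]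
  have "quotient_carrier L N \<subseteq> quotient_carrier M N"
    using \<open>L \<subseteq> M\<close> by (auto simp: quotient_carrier_def)
  then show ?thesis
    using L by (simp add: quotient_submodule_def mem submodule_def)
qed

lemma quotient_submodule_is_carrier:
  assumes N: "submodule smul \<rho> N" and M: "submodule smul \<rho> M" and "N \<subseteq> M"
    and Q: "quotient_submodule smul \<rho> M N Q"
  obtains L where "submodule smul \<rho> L" "N \<subseteq> L" "L \<subseteq> M" "Q = quotient_carrier L N"
proof
  let ?L = "{x \<in> M. add_coset x N \<in> Q}"
  show "submodule smul \<rho> ?L"
    using M Q by (simp add: submodule_def quotient_submodule_def)
  have "add_coset x N = add_coset 0 N" if "x \<in> N" for x
    using that by (simp add: add_coset_eq_iff[OF submodule_subspace[OF N]])
  then show "N \<subseteq> ?L"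
    using Q \<open>N \<subseteq> M\<close> by (auto simp: quotient_submodule_def)
  have "Q \<subseteq> quotient_carrier M N"
    using Q by (simp add: quotient_submodule_def)
  then show "Q = quotient_carrier ?L N"
    by (auto simp: quotient_carrier_def)
qed blast

text \<open>The correspondence theorem: submodules of the quotient are the images of the submodules in
  between.\<close>

lemma simple_quotient_iff:
  assumes N: "submodule smul \<rho> N" and M: "submodule smul \<rho> M" and NM: "N \<subseteq> M"
  shows "simple_quotient smul \<rho> M N \<longleftrightarrow>
    N \<noteq> M \<and> (\<forall>L. submodule smul \<rho> L \<longrightarrow> N \<subseteq> L \<longrightarrow> L \<subseteq> M \<longrightarrow> L = N \<or> L = M)"
proof -
  note subN = submodule_subspace[OF N] and subM = submodule_subspace[OF M]
  have eq: "quotient_carrier L N = quotient_carrier L' N \<longleftrightarrow> L = L'"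
    if "submodule smul \<rho> L" "N \<subseteq> L" "submodule smul \<rho> L'" "N \<subseteq> L'" for L L'
    using quotient_carrier_eq_iff[OF subN] that submodule_subspace by blast
  show ?thesis
    unfolding simple_quotient_def quotient_carrier_self[OF subN, symmetric]
    using eq N M NM quotient_submodule_carrier[OF N] quotient_submodule_is_carrier[OF N M NM]
    by (smt (verit) order_refl)
qed

lemma simple_submodule_iff:
  assumes "submodule smul \<rho> M"
  shows "simple_submodule smul \<rho> M \<longleftrightarrow> simple_quotient smul \<rho> M {0}"
proof -
  have zero: "submodule smul \<rho> {0}"
    by (simp add: submodule_def R.zero)
  have mem: "0 \<in> L" if "submodule smul \<rho> L" for L
    using that by (simp add: submodule_def)
  show ?thesis
    using assms mem by (auto simp: simple_submodule_def simple_quotient_iff[OF zero])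
qed

end

section \<open>Maximal submodules, composition series and decompositions\<close>

lemma dvd_degree_eq:
  fixes f g :: "complex poly"
  assumes "f dvd g" "degree f = degree g" "g \<noteq> 0"
  shows "g dvd f"
proof -
  obtain r where r: "g = f * r" using assms(1) by (rule dvdE)
  then have "f \<noteq> 0" "r \<noteq> 0" using assms(3) by auto
  then have "is_unit r" using r assms(2) by (simp add: degree_mult_eq is_unit_iff_degree)
  then show ?thesis using r by (simp add: mult_unit_dvd_iff)
qed

lemma dvd_linear_extension:
  fixes f g :: "complex poly"
  assumes "f dvd g" "\<not> g dvd f"
  obtains x where "f * [:- x, 1:] dvd g"
proof -
  obtain r where r: "g = f * r" using assms(1) by (rule dvdE)
  have "\<not> is_unit r" using assms(2) r by (auto simp: mult_unit_dvd_iff)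
  then obtain x where "poly r x = 0" by (rule complex_poly_nonunit_root)
  then have "[:- x, 1:] dvd r" by (simp add: poly_eq_0_iff_dvd)
  then have "f * [:- x, 1:] dvd g" unfolding r by (intro mult_dvd_mono dvd_refl)
  then show ?thesis by (rule that)
qed

lemma degree_mult_linear:
  fixes f :: "complex poly"
  assumes "f \<noteq> 0"
  shows "degree (f * [:- x, 1:]) = Suc (degree f)"
  using assms by (subst degree_mult_eq) simp_all

context quasi_whittaker_annihilated
begin

text \<open>Over the complex numbers a proper multiple of \<open>f\<close> that has no proper divisor strictly
  between is \<open>f\<close> times a linear factor. Hence composition length counts degrees, which gives the
  existence of composition series and the uniqueness of their length without the Jordan-Hoelder
  theorem.\<close>

lemma simple_quotient_range_iff:
  assumes fg: "f dvd g" and gd: "g dvd d"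
  shows "simple_quotient smul \<rho> (range (central_act f)) (range (central_act g)) \<longleftrightarrow> degree g = Suc (degree f)"
proof -
  have fd: "f dvd d" using fg gd by (rule dvd_trans)
  have nz: "f \<noteq> 0" "g \<noteq> 0" using fd gd d_nonzero by auto
  note iff = simple_quotient_iff[OF submodule_range submodule_range range_central_act_mono[OF fg]]
  show ?thesis
  proof
    assume simple: "simple_quotient smul \<rho> (range (central_act f)) (range (central_act g))"
    then have "range (central_act g) \<noteq> range (central_act f)"
      unfolding iff by (rule conjunct1)
    then have "\<not> g dvd f"
      using range_central_act_mono fg by blast
    with fg obtain x where x: "f * [:- x, 1:] dvd g" by (rule dvd_linear_extension)
    let ?c = "f * [:- x, 1:]"
    have "range (central_act ?c) = range (central_act g) \<or> range (central_act ?c) = range (central_act f)"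
      using simple[unfolded iff, THEN conjunct2, rule_format, OF submodule_range
          range_central_act_mono[OF x] range_central_act_mono[OF dvd_triv_left]] .
    moreover have "range (central_act ?c) \<noteq> range (central_act f)"
    proof
      assume "range (central_act ?c) = range (central_act f)"
      then have "?c dvd f"
        using range_central_act_le_iff[OF dvd_trans[OF x gd], of f] by (simp only: order_refl)
      then show False
        using dvd_imp_degree_le[OF _ nz(1)] degree_mult_linear[OF nz(1)] by fastforce
    qed
    ultimately have "range (central_act ?c) = range (central_act g)" by blast
    then have "g dvd ?c"
      using range_central_act_le_iff[OF gd, of ?c] by (simp only: order_refl)
    then have "degree g = degree ?c"
      using x nz by (intro antisym dvd_imp_degree_le) auto
    then show "degree g = Suc (degree f)"
      using degree_mult_linear[OF nz(1)] by simp
  next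
    assume deg: "degree g = Suc (degree f)"
    show "simple_quotient smul \<rho> (range (central_act f)) (range (central_act g))"
      unfolding iff
    proof (intro conjI allI impI)
      show "range (central_act g) \<noteq> range (central_act f)"
      proof
        assume "range (central_act g) = range (central_act f)"
        then have "g dvd f"
          using range_central_act_le_iff[OF gd, of f] by (simp only: order_refl)
        then show False using dvd_imp_degree_le[OF _ nz(1)] deg by fastforce
      qed
      fix L assume L: "submodule smul \<rho> L" "range (central_act g) \<subseteq> L" "L \<subseteq> range (central_act f)"
      obtain c where c: "c dvd d" "L = range (central_act c)"
        using submodule_eq_range[OF L(1)] .
      then have fc: "f dvd c" and cg: "c dvd g"
        using L range_central_act_le_iff[OF fd, of c] range_central_act_le_iff[OF c(1), of g] by auto
      have "c \<noteq> 0" using c d_nonzero by auto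
      have "degree f = degree c \<or> degree c = degree g"
        using dvd_imp_degree_le[OF fc \<open>c \<noteq> 0\<close>] dvd_imp_degree_le[OF cg nz(2)] deg by linarith
      then show "L = range (central_act g) \<or> L = range (central_act f)"
      proof
        assume "degree f = degree c"
        then have "c dvd f" using dvd_degree_eq fc \<open>c \<noteq> 0\<close> by blast
        then show ?thesis using range_central_act_mono fc c(2) by blast
      next
        assume "degree c = degree g"
        then have "g dvd c" using dvd_degree_eq cg nz(2) by blast
        then show ?thesis using range_central_act_mono cg c(2) by blast
      qed
    qed
  qed
qed

lemma composition_series_exists:
  assumes "f dvd d"
  shows "\<exists>N. composition_series smul \<rho> (range (central_act f)) (degree d - degree f) N"
  using assms
proof (induction "degree d - degree f" arbitrary: f)
  case 0
  then have "d dvd f"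
    using dvd_degree_eq dvd_imp_degree_le[OF \<open>f dvd d\<close> d_nonzero] d_nonzero by simp
  then have "range (central_act f) = {0}"
    by (simp only: range_central_act_eq_0_iff)
  then show ?case
    using submodule_range[of f] 0 by (auto simp: composition_series_def intro!: exI[of _ "\<lambda>_. {0}"])
next
  case (Suc n)
  have "f \<noteq> 0" using Suc.prems d_nonzero by auto
  then have "\<not> d dvd f"
    using dvd_imp_degree_le[of d f] Suc.hyps(2) by auto
  with \<open>f dvd d\<close> obtain x where x: "f * [:- x, 1:] dvd d" by (rule dvd_linear_extension)
  let ?g = "f * [:- x, 1:]"
  have deg: "degree ?g = Suc (degree f)" by (rule degree_mult_linear[OF \<open>f \<noteq> 0\<close>])
  then have "n = degree d - degree ?g" using Suc.hyps(2) by simp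
  from Suc.hyps(1)[OF this x] obtain N
    where N: "composition_series smul \<rho> (range (central_act ?g)) n N" using \<open>n = _\<close> by auto
  have "simple_quotient smul \<rho> (range (central_act f)) (range (central_act ?g))"
    using simple_quotient_range_iff[OF dvd_triv_left x] deg by blast
  then have "composition_series smul \<rho> (range (central_act f)) (Suc n) (N(Suc n := range (central_act f)))"
    using N range_central_act_mono[OF dvd_triv_left, of f "[:- x, 1:]"] submodule_range[of f]
    unfolding composition_series_def by (auto simp: less_Suc_eq le_Suc_eq simp del: mult_pCons_right)
  then show ?case using Suc.hyps(2) by auto
qed

lemma composition_series_length:
  assumes "f dvd d" "composition_series smul \<rho> (range (central_act f)) m N"
  shows "degree d = degree f + m"
  using assms
proof (induction m arbitrary: f)
  case 0
  then have "range (central_act f) = {0}" by (auto simp: composition_series_def)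
  then have "d dvd f" by (simp only: range_central_act_eq_0_iff)
  moreover have "f \<noteq> 0" using 0 d_nonzero by auto
  ultimately show ?case
    using 0 d_nonzero by (simp add: antisym dvd_imp_degree_le)
next
  case (Suc m)
  then have N: "submodule smul \<rho> (N m)" "N m \<subseteq> N (Suc m)"
    "simple_quotient smul \<rho> (N (Suc m)) (N m)" and top: "N (Suc m) = range (central_act f)"
    using Suc.prems(2) unfolding composition_series_def
    by (blast intro: lessI less_imp_le)+
  obtain g where g: "g dvd d" "N m = range (central_act g)"
    using submodule_eq_range[OF N(1)] .
  have "f dvd g"
    using N(2) range_central_act_le_iff[OF Suc.prems(1), of g] by (simp only: g top)
  then have "degree g = Suc (degree f)"
    using N(3) simple_quotient_range_iff g top by simp
  moreover have "degree d = degree g + m"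
    using Suc.IH[OF g(1)] Suc.prems(2) g(2) by (simp add: composition_series_def)
  ultimately show ?case by simp
qed

lemma composition_length_range:
  assumes "f dvd d"
  shows "has_composition_length smul \<rho> (range (central_act f)) (degree d - degree f)"
  using composition_series_exists[OF assms] composition_series_length[OF assms]
  by (fastforce simp: has_composition_length_def)

lemma simple_range_iff:
  assumes "f dvd d"
  shows "simple_submodule smul \<rho> (range (central_act f)) \<longleftrightarrow> degree d = Suc (degree f)"
proof -
  have "range (central_act d) = {0}" by (simp only: range_central_act_eq_0_iff dvd_refl)
  then show ?thesis
    using simple_quotient_range_iff[OF assms dvd_refl] simple_submodule_iff[OF submodule_range]
    by simp
qed

text \<open>When only one root is left, every nonzero submodule contains the one of \<open>c l\<^sup>n\<close>, with \<open>l\<close>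
  the linear factor, so two nonzero submodules never intersect trivially.\<close>

lemma indecomposable_range:
  assumes d: "d = c * [:- x, 1:] ^ Suc n"
  shows "indecomposable smul \<rho> (range (central_act c))"
proof -
  let ?l = "[:- x, 1:]"
  let ?s = "c * ?l ^ n"
  have "c \<noteq> 0" using d d_nonzero by auto
  have cd: "c dvd d" using d by simp
  have "degree d = Suc (degree ?s)"
    using \<open>c \<noteq> 0\<close> d by (simp add: degree_mult_eq degree_power_eq del: power_Suc)
  then have "\<not> d dvd ?s"
    using dvd_imp_degree_le[of d ?s] \<open>c \<noteq> 0\<close> by auto
  then have socle_nz: "range (central_act ?s) \<noteq> {0}"
    by (simp only: range_central_act_eq_0_iff not_False_eq_True)
  have socle: "range (central_act ?s) \<subseteq> A"
    if A: "submodule smul \<rho> A" "A \<noteq> {0}" "A \<subseteq> range (central_act c)" for A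
  proof -
    obtain f where f: "f dvd d" "A = range (central_act f)"
      using submodule_eq_range[OF A(1)] .
    have "c dvd f" using A(3) range_central_act_le_iff[OF cd, of f] f(2) by (simp only:)
    then obtain r where r: "f = c * r" by (rule dvdE)
    obtain t where "d = f * t" using f(1) by (rule dvdE)
    then have t: "?l ^ Suc n = r * t" using d r \<open>c \<noteq> 0\<close> by (simp add: mult.assoc del: power_Suc)
    have "\<not> d dvd f" using A(2) f(2) by (simp only: range_central_act_eq_0_iff not_False_eq_True)
    then have "\<not> is_unit t" using \<open>d = f * t\<close> by (auto simp: mult_unit_dvd_iff)
    then obtain y where y: "poly t y = 0" by (rule complex_poly_nonunit_root)
    have "poly (?l ^ Suc n) y = 0" using y by (simp only: t poly_mult mult_zero_right)
    then have "y = x" by (auto simp: poly_power simp del: power_Suc)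
    then have "?l dvd t" using y by (simp add: poly_eq_0_iff_dvd)
    then obtain t' where "t = ?l * t'" by (rule dvdE)
    then have "?l * ?l ^ n = ?l * (r * t')" using t by (simp only: power_Suc ac_simps)
    then have "?l ^ n = r * t'" by (simp only: mult_cancel_left) simp
    then have "f dvd ?s" by (simp add: r)
    then show ?thesis using range_central_act_mono f(2) by blast
  qed
  have sub_c: "range (central_act ?s) \<subseteq> range (central_act c)" by (rule range_central_act_mono) simp
  have zero: "0 \<in> A" if "submodule smul \<rho> A" for A
    using that by (simp add: submodule_def)
  show ?thesis
    unfolding indecomposable_def
  proof (intro conjI notI)
    assume "range (central_act c) = {0}"
    then show False using sub_c socle_nz zero[OF submodule_range[of ?s]] by blast
  next
    assume "\<exists>A B. submodule smul \<rho> A \<and> submodule smul \<rho> B \<and> A \<noteq> {0} \<and> B \<noteq> {0} \<and>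
      range (central_act c) = {a + b |a b. a \<in> A \<and> b \<in> B} \<and> A \<inter> B = {0}"
    then obtain A B where A: "submodule smul \<rho> A" "A \<noteq> {0}" and B: "submodule smul \<rho> B" "B \<noteq> {0}"
      and sum: "range (central_act c) = {a + b |a b. a \<in> A \<and> b \<in> B}" and int: "A \<inter> B = {0}"
      by blast
    have "x \<in> {a + b |a b. a \<in> A \<and> b \<in> B}" if "x \<in> A" for x
      using that zero[OF B(1)] by (intro CollectI exI[of _ x] exI[of _ 0]) simp
    moreover have "x \<in> {a + b |a b. a \<in> A \<and> b \<in> B}" if "x \<in> B" for x
      using that zero[OF A(1)] by (intro CollectI exI[of _ 0] exI[of _ x]) simp
    ultimately have "A \<subseteq> range (central_act c)" "B \<subseteq> range (central_act c)"
      unfolding sum by blast+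
    then have "range (central_act ?s) \<subseteq> A \<inter> B"
      using socle[OF A] socle[OF B] by blast
    then show False
      using int socle_nz zero[OF submodule_range[of ?s]] by blast
  qed (rule submodule_range)
qed

lemma maximal_submodules:
  "{N. maximal_submodule smul \<rho> N} = (\<lambda>x. range (central_act [:- x, 1:])) ` {x. poly d x = 0}"
proof (intro equalityI subsetI)
  fix N assume "N \<in> {N. maximal_submodule smul \<rho> N}"
  then have N: "submodule smul \<rho> N" "N \<noteq> UNIV"
    and max: "\<And>L. submodule smul \<rho> L \<Longrightarrow> N \<subseteq> L \<Longrightarrow> L = N \<or> L = UNIV"
    by (auto simp: maximal_submodule_def)
  obtain g where g: "g dvd d" "N = range (central_act g)"
    using submodule_eq_range[OF N(1)] .
  then have "\<not> is_unit g" using N(2) range_central_act_eq_UNIV_iff[OF g(1)] by simp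
  then obtain x where "poly g x = 0" by (rule complex_poly_nonunit_root)
  then have l: "[:- x, 1:] dvd g" by (simp add: poly_eq_0_iff_dvd)
  have "range (central_act [:- x, 1:]) \<noteq> UNIV"
    using range_central_act_eq_UNIV_iff[OF dvd_trans[OF l g(1)]] by (simp add: is_unit_iff_degree)
  then have "range (central_act [:- x, 1:]) = N"
    using max[OF submodule_range] range_central_act_mono[OF l] g(2) by blast
  moreover have "poly d x = 0"
    using dvd_trans[OF l g(1)] by (simp add: poly_eq_0_iff_dvd)
  ultimately show "N \<in> (\<lambda>x. range (central_act [:- x, 1:])) ` {x. poly d x = 0}" by blast
next
  fix N assume "N \<in> (\<lambda>x. range (central_act [:- x, 1:])) ` {x. poly d x = 0}"
  then obtain x where x: "poly d x = 0" and N: "N = range (central_act [:- x, 1:])" by blast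
  have l: "[:- x, 1:] dvd d" using x by (simp add: poly_eq_0_iff_dvd)
  have "N \<noteq> UNIV"
    unfolding N range_central_act_eq_UNIV_iff[OF l] by (simp add: is_unit_iff_degree)
  moreover have "L = N \<or> L = UNIV" if L: "submodule smul \<rho> L" "N \<subseteq> L" for L
  proof -
    obtain f where f: "f dvd d" "L = range (central_act f)"
      using submodule_eq_range[OF L(1)] .
    then have fl: "f dvd [:- x, 1:]"
      using L(2) range_central_act_le_iff[OF f(1)] by (simp only: N)
    show ?thesis
    proof (cases "is_unit f")
      case True
      then show ?thesis using range_central_act_eq_UNIV_iff[OF f(1)] f(2) by simp
    next
      case False
      then obtain y where y: "poly f y = 0" by (rule complex_poly_nonunit_root)
      then have "poly [:- x, 1:] y = 0" using fl by (metis dvdE mult_zero_left poly_mult)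
      then have "[:- x, 1:] dvd f" using y by (simp add: poly_eq_0_iff_dvd)
      then show ?thesis using range_central_act_mono L(2) f(2) N by blast
    qed
  qed
  ultimately show "N \<in> {N. maximal_submodule smul \<rho> N}"
    using submodule_range by (simp add: maximal_submodule_def N)
qed

lemma quasi_whittaker_range:
  assumes "\<not> d dvd c"
  shows "quasi_whittaker_module smul \<rho> \<phi> (range (central_act c)) (central_act c w)"
proof -
  have "\<rho> x (central_act c w) = smul (\<phi> x) (central_act c w)" if "x \<in> heisenberg" for x
    using heisenberg_w[OF that] central_act.scale by (simp flip: central_act_act)
  then show ?thesis
    using assms submodule_range[of c] central_act_w_eq_0_iff[of c]
    by (simp add: quasi_whittaker_module_def quasi_whittaker_vector_def cyclic_submodule_central_act)
qed

lemma central_act_multiple_d: "d dvd g \<Longrightarrow> central_act g v = 0"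
  using range_central_act_eq_0_iff[of g] by blast

text \<open>A Bezout identity provides orthogonal idempotents: \<open>u\<^sub>i c\<^sub>i\<close> acts as the identity on the
  \<open>i\<close>-th submodule and as zero on the others, hence it is the projection.\<close>

lemma direct_sum_ranges:
  assumes fin: "finite I" and bezout: "(\<Sum>i\<in>I. u i * c i) = 1"
    and ortho: "\<And>i j. i \<in> I \<Longrightarrow> j \<in> I \<Longrightarrow> i \<noteq> j \<Longrightarrow> d dvd c i * c j"
  shows "internal_direct_sum I (\<lambda>i. range (central_act (c i))) UNIV"
proof -
  have sum: "v = (\<Sum>i\<in>I. central_act (u i * c i) v)" for v
    using central_act_1[of v] by (simp flip: bezout central_act_sum)
  have zero: "central_act (u i * c i) x = 0"
    if ij: "i \<in> I" "j \<in> I" "i \<noteq> j" and x: "x \<in> range (central_act (c j))" for i j x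
  proof -
    from x obtain y where "x = central_act (c j) y" by blast
    then have "central_act (u i * c i) x = central_act (u i * (c i * c j)) y" by (simp add: central_act_mult)
    then show ?thesis using central_act_multiple_d ortho[OF ij] by simp
  qed
  have component: "f i = central_act (u i * c i) v"
    if f: "f \<in> (\<Pi>\<^sub>E i\<in>I. range (central_act (c i)))" "v = (\<Sum>i\<in>I. f i)" and i: "i \<in> I" for f v i
  proof -
    have mem: "f j \<in> range (central_act (c j))" if "j \<in> I" for j
      using f(1) that by auto
    have "central_act (u i * c i) v = (\<Sum>j\<in>I. if j = i then central_act (u i * c i) (f i) else 0)"
      unfolding f(2) central_act.sum by (rule sum.cong) (use zero i mem in auto)
    also have "\<dots> = (\<Sum>j\<in>I. if j = i then central_act (u j * c j) (f i) else 0)"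
      by (rule sum.cong) auto
    also have "\<dots> = (\<Sum>j\<in>I. central_act (u j * c j) (f i))"
      by (rule sum.cong) (use zero i mem in auto)
    also have "\<dots> = f i" using sum[of "f i"] by simp
    finally show ?thesis by simp
  qed
  show ?thesis
    unfolding internal_direct_sum_def
  proof (intro conjI ballI)
    fix v
    show "\<exists>!f. f \<in> (\<Pi>\<^sub>E i\<in>I. range (central_act (c i))) \<and> v = (\<Sum>i\<in>I. f i)"
    proof (rule ex1I)
      show "(\<lambda>i\<in>I. central_act (u i * c i) v) \<in> (\<Pi>\<^sub>E i\<in>I. range (central_act (c i)))
          \<and> v = (\<Sum>i\<in>I. (\<lambda>i\<in>I. central_act (u i * c i) v) i)"
        using sum[of v] central_act_mult_swap[of "u _" "c _" v] by auto
      fix f assume f: "f \<in> (\<Pi>\<^sub>E i\<in>I. range (central_act (c i))) \<and> v = (\<Sum>i\<in>I. f i)"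
      show "f = (\<lambda>i\<in>I. central_act (u i * c i) v)"
      proof
        fix i show "f i = (\<lambda>i\<in>I. central_act (u i * c i) v) i"
          using component[of f v i] f by (cases "i \<in> I") (auto simp: PiE_def extensional_def)
      qed
    qed
  qed auto
qed

end

theorem theorem5p2:
  fixes smul :: "complex \<Rightarrow> 'v \<Rightarrow> 'v::ab_group_add"
    and \<rho> :: "schrodinger \<Rightarrow> 'v \<Rightarrow> 'v"
    and \<phi> :: "schrodinger \<Rightarrow> complex"
    and w :: 'v
    and k :: nat
    and \<xi> :: "nat \<Rightarrow> complex"
    and a :: "nat \<Rightarrow> nat"
  assumes "schrodinger_module smul \<rho>"
    and "heisenberg_hom \<phi>"
    and "\<exists>x\<in>heisenberg. \<phi> x \<noteq> 0"
    and "quasi_whittaker_module smul \<rho> \<phi> UNIV w"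
    and "ann_C0 smul \<rho> w \<noteq> {0}"
    and "inj_on \<xi> {1..k}"
    and "\<forall>i\<in>{1..k}. a i \<ge> 1"
    and "monic_generator (\<Prod>i\<in>{1..k}. [:- \<xi> i, 1:] ^ a i) (ann_C0 smul \<rho> w)"
  shows
    "{N. maximal_submodule smul \<rho> N} =
       (\<lambda>i. cyclic_submodule smul \<rho> (uea_act smul \<rho> (C0 - uea_const (\<xi> i)) w)) ` {1..k}
     \<and>
     (let d = (\<lambda>j. \<Prod>i\<in>{1..k} - {j}. [:- \<xi> i, 1:] ^ a i);
          w' = (\<lambda>j. uea_act smul \<rho> (poly_C0 (d j)) w);
          V = (\<lambda>j. cyclic_submodule smul \<rho> (w' j))
      in (\<forall>j\<in>{1..k}. quasi_whittaker_module smul \<rho> \<phi> (V j) (w' j)) \<and>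
         internal_direct_sum {1..k} V UNIV \<and>
         (\<forall>j\<in>{1..k}. indecomposable smul \<rho> (V j)) \<and>
         (\<forall>j\<in>{1..k}. simple_submodule smul \<rho> (V j) \<longleftrightarrow> a j = 1) \<and>
         (\<forall>j\<in>{1..k}. has_composition_length smul \<rho> (V j) (a j)) \<and>
         (\<exists>N. composition_series smul \<rho> UNIV (\<Sum>i\<in>{1..k}. a i) N))"
proof -
  define l where "l i = [:- \<xi> i, 1:]" for i
  define D where "D = (\<Prod>i\<in>{1..k}. l i ^ a i)"
  define c where "c j = (\<Prod>i\<in>{1..k} - {j}. l i ^ a i)" for j
  interpret quasi_whittaker_annihilated smul \<rho> \<phi> w D
    using assms by unfold_locales (simp_all add: D_def l_def)
  have l_nz: "l i \<noteq> 0" and deg_l: "degree (l i ^ n) = n" for i n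
    by (simp_all add: l_def degree_linear_power)
  have c_nz: "c j \<noteq> 0" for j
    using l_nz by (simp add: c_def)
  have D_split: "D = c j * l j ^ a j" if "j \<in> {1..k}" for j
    using that unfolding D_def c_def by (subst prod.remove[of _ j]) (simp_all add: mult.commute)
  have cD: "c j dvd D" if "j \<in> {1..k}" for j
    using D_split[OF that] by simp
  have deg_D: "degree D = degree (c j) + a j" if "j \<in> {1..k}" for j
    using c_nz[of j] l_nz[of j] deg_l[of j "a j"]
    by (simp add: D_split[OF that] degree_mult_eq)
  have total_degree: "degree D = (\<Sum>i\<in>{1..k}. a i)"
    using l_nz by (simp add: D_def degree_prod_eq_sum_degree deg_l)
  have a_pos: "a j \<ge> 1" if "j \<in> {1..k}" for j
    using assms(7) that by blast
  have roots: "{x. poly D x = 0} = \<xi> ` {1..k}"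
    using a_pos by (force simp: D_def poly_prod l_def poly_power)
  have "w \<noteq> 0"
    using cyclic by (simp add: quasi_whittaker_module_def quasi_whittaker_vector_def)
  have k: "{1..k} \<noteq> {}"
  proof
    assume "{1..k} = {}"
    then have "D = 1" by (simp only: D_def prod.empty)
    then show False using \<open>w \<noteq> 0\<close> central_act_w_eq_0_iff[of 1] by (simp add: central_act_1)
  qed
  have no_common_root: "\<exists>i\<in>{1..k}. poly (c i) x \<noteq> 0" for x
  proof (cases "x \<in> \<xi> ` {1..k}")
    case True
    then obtain i where i: "i \<in> {1..k}" and x: "x = \<xi> i" by blast
    have "\<xi> i \<noteq> \<xi> m" if "m \<in> {1..k} - {i}" for m
      using inj_onD[OF assms(6), of i m] i that by blast
    then have "poly (c i) x \<noteq> 0"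
      unfolding c_def poly_prod x by (subst prod_zero_iff) (simp_all add: l_def)
    with i show ?thesis by blast
  next
    case False
    then have "poly D x \<noteq> 0" using roots by blast
    moreover obtain i where "i \<in> {1..k}" using k by blast
    ultimately show ?thesis using D_split[of i] by auto
  qed
  obtain u where bezout: "(\<Sum>i\<in>{1..k}. u i * c i) = 1"
    using poly_bezout[OF finite_atLeastAtMost no_common_root] .
  have ortho: "D dvd c i * c j" if "i \<in> {1..k}" "j \<in> {1..k}" "i \<noteq> j" for i j
  proof -
    have "l i ^ a i dvd c j"
      unfolding c_def by (rule dvd_prodI) (use that in auto)
    then show ?thesis
      unfolding D_split[OF that(1)] by (intro mult_dvd_mono dvd_refl)
  qed
  have w': "uea_act smul \<rho> (poly_C0 (\<Prod>i\<in>{1..k} - {j}. [:- \<xi> i, 1:] ^ a i)) w = central_act (c j) w" for j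
    by (simp only: central_act_def c_def l_def)
  have maximal: "{N. maximal_submodule smul \<rho> N} =
       (\<lambda>i. cyclic_submodule smul \<rho> (uea_act smul \<rho> (C0 - uea_const (\<xi> i)) w)) ` {1..k}"
    unfolding maximal_submodules roots central_act_linear_factor[symmetric] cyclic_submodule_central_act image_image ..
  have whittaker: "quasi_whittaker_module smul \<rho> \<phi> (range (central_act (c j))) (central_act (c j) w)"
    if "j \<in> {1..k}" for j
  proof (rule quasi_whittaker_range)
    show "\<not> D dvd c j"
      using dvd_imp_degree_le[OF _ c_nz[of j], of D] deg_D[OF that] a_pos[OF that] by auto
  qed
  have direct_sum: "internal_direct_sum {1..k} (\<lambda>j. range (central_act (c j))) UNIV"
    by (rule direct_sum_ranges[OF finite_atLeastAtMost bezout ortho])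
  have indecomposable: "indecomposable smul \<rho> (range (central_act (c j)))" if "j \<in> {1..k}" for j
  proof (rule indecomposable_range)
    show "D = c j * [:- \<xi> j, 1:] ^ Suc (a j - 1)"
      using D_split[OF that] a_pos[OF that] by (simp add: l_def del: power_Suc)
  qed
  have simple: "simple_submodule smul \<rho> (range (central_act (c j))) \<longleftrightarrow> a j = 1" if "j \<in> {1..k}" for j
    using simple_range_iff[OF cD[OF that]] deg_D[OF that] by simp
  have length: "has_composition_length smul \<rho> (range (central_act (c j))) (a j)" if "j \<in> {1..k}" for j
    using composition_length_range[OF cD[OF that]] deg_D[OF that] by simp
  have series: "\<exists>N. composition_series smul \<rho> UNIV (\<Sum>i\<in>{1..k}. a i) N"
  proof -
    have "range (central_act 1) = UNIV"
      by (simp only: range_central_act_eq_UNIV_iff[OF one_dvd] one_dvd)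
    then show ?thesis
      using composition_series_exists[OF one_dvd] by (simp add: total_degree)
  qed
  show ?thesis
    unfolding Let_def w' cyclic_submodule_central_act
    by (intro conjI ballI maximal whittaker direct_sum indecomposable simple length series)
qed

end
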